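(* Let $E$ be a compact subset of $\widehat{\mathbb Z}=\prod_{p\in\mathbb P}\mathbb Z_p$ and, for each prime $p$, let $E_p=\pi_p(E)$ be its image under the projection onto $\mathbb Z_p$. The $\mathbb Z$-module $\mathrm{Int}_{\mathbb Q}(E,\widehat{\mathbb Z})$ admits a regular basis if and only if both of the following conditions hold: 1. $E_p$ is infinite for all $p\in\mathbb P$; 2. for each $n\geq 0$, $\#(E_p \bmod p)>n$ for all but finitely many $p\in\mathbb P$.
   Context: $\mathbb P$ is the set of primes; $\widehat{\mathbb Z}=\prod_p\mathbb Z_p$ has the product topology. $\mathrm{Int}_{\mathbb Q}(E,\widehat{\mathbb Z})=\{f\in\mathbb Q[x]\mid \forall (\alpha_p)_p\in E,\ \forall p\in\mathbb P,\ f(\alpha_p)\in\mathbb Z_p\}$. A regular basis of this $\mathbb Z$-module is a $\mathbb Z$-basis consisting of exactly one polynomial of each degree, i.e. a basis $\{f_n\}_{n\ge0}$ with $\deg f_n=n$ for all $n$. $\#(E_p\bmod p)$ is the cardinality of the image of $E_p$ in $\mathbb Z_p/p\mathbb Z_p$. *)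

theory Defs
  imports
    "HOL-Algebra.QuotRing"
    "HOL-Analysis.Function_Topology"
    "HOL-Computational_Algebra.Computational_Algebra"
begin

section \<open>The field of fractions of an integral domain\<close>

definition frac_rel :: "('a, 'm) ring_scheme \<Rightarrow> (('a \<times> 'a) \<times> ('a \<times> 'a)) set" where
  "frac_rel R = {((a, b), (c, d)).
     a \<in> carrier R \<and> b \<in> carrier R - {\<zero>\<^bsub>R\<^esub>} \<and> c \<in> carrier R \<and> d \<in> carrier R - {\<zero>\<^bsub>R\<^esub>} \<and>
     a \<otimes>\<^bsub>R\<^esub> d = c \<otimes>\<^bsub>R\<^esub> b}"

definition fraction :: "('a, 'm) ring_scheme \<Rightarrow> 'a \<Rightarrow> 'a \<Rightarrow> ('a \<times> 'a) set" where
  "fraction R a b = frac_rel R `` {(a, b)}"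

definition frac_field :: "('a, 'm) ring_scheme \<Rightarrow> ('a \<times> 'a) set ring" where
  "frac_field R =
    \<lparr>carrier = (carrier R \<times> (carrier R - {\<zero>\<^bsub>R\<^esub>})) // frac_rel R,
     monoid.mult = (\<lambda>X Y. \<Union>(a, b)\<in>X. \<Union>(c, d)\<in>Y. fraction R (a \<otimes>\<^bsub>R\<^esub> c) (b \<otimes>\<^bsub>R\<^esub> d)),
     monoid.one = fraction R \<one>\<^bsub>R\<^esub> \<one>\<^bsub>R\<^esub>,
     ring.zero = fraction R \<zero>\<^bsub>R\<^esub> \<one>\<^bsub>R\<^esub>,
     ring.add = (\<lambda>X Y. \<Union>(a, b)\<in>X. \<Union>(c, d)\<in>Y.
                   fraction R (a \<otimes>\<^bsub>R\<^esub> d \<oplus>\<^bsub>R\<^esub> c \<otimes>\<^bsub>R\<^esub> b) (b \<otimes>\<^bsub>R\<^esub> d))\<rparr>"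

definition frac_embed :: "('a, 'm) ring_scheme \<Rightarrow> 'a \<Rightarrow> ('a \<times> 'a) set" where
  "frac_embed R a = fraction R a \<one>\<^bsub>R\<^esub>"

context "domain" begin

lemma frac_rel_equiv: "equiv (carrier R \<times> (carrier R - {\<zero>})) (frac_rel R)"
proof (rule equivI)
  show "frac_rel R \<subseteq> (carrier R \<times> (carrier R - {\<zero>})) \<times> (carrier R \<times> (carrier R - {\<zero>}))"
    by (auto simp: frac_rel_def)
  show "refl_on (carrier R \<times> (carrier R - {\<zero>})) (frac_rel R)"
    by (auto simp: frac_rel_def refl_on_def)
  show "sym (frac_rel R)"
    by (auto simp: frac_rel_def sym_def)
  show "trans (frac_rel R)"
  proof (rule transI, clarsimp simp: frac_rel_def)
    fix a b c d e f
    assume c: "a \<in> carrier R" "b \<in> carrier R" "c \<in> carrier R" "d \<in> carrier R" "e \<in> carrier R"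
      "f \<in> carrier R" and nz: "d \<noteq> \<zero>"
      and 1: "a \<otimes> d = c \<otimes> b" and 2: "c \<otimes> f = e \<otimes> d"
    have "d \<otimes> (a \<otimes> f) = (a \<otimes> d) \<otimes> f" using c by (simp add: m_ac)
    also have "\<dots> = (c \<otimes> f) \<otimes> b" using c 1 by (simp add: m_ac)
    also have "\<dots> = d \<otimes> (e \<otimes> b)" using c 2 by (simp add: m_ac)
    finally show "a \<otimes> f = e \<otimes> b" using c nz m_lcancel by simp
  qed
qed

lemma frac_eq_iff:
  assumes "a \<in> carrier R" "b \<in> carrier R - {\<zero>}" "c \<in> carrier R" "d \<in> carrier R - {\<zero>}"
  shows "fraction R a b = fraction R c d \<longleftrightarrow> a \<otimes> d = c \<otimes> b"
  unfolding fraction_def using eq_equiv_class_iff[OF frac_rel_equiv, of "(a,b)" "(c,d)"] assms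
  by (auto simp: frac_rel_def)

lemma carrier_frac_field:
  "carrier (frac_field R) = {fraction R a b | a b. a \<in> carrier R \<and> b \<in> carrier R - {\<zero>}}"
  by (auto simp: frac_field_def quotient_def fraction_def)

lemma frac_field_mult:
  assumes "a \<in> carrier R" "b \<in> carrier R - {\<zero>}" "c \<in> carrier R" "d \<in> carrier R - {\<zero>}"
  shows "fraction R a b \<otimes>\<^bsub>frac_field R\<^esub> fraction R c d = fraction R (a \<otimes> c) (b \<otimes> d)"
proof -
  have "congruent2 (frac_rel R) (frac_rel R) (\<lambda>(a, b) (c, d). fraction R (a \<otimes> c) (b \<otimes> d))"
  proof (rule congruent2I', clarsimp simp: frac_rel_def)
    fix a b c d a' b' c' d'
    assume c: "a \<in> carrier R" "b \<in> carrier R" "c \<in> carrier R" "d \<in> carrier R"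
      "a' \<in> carrier R" "b' \<in> carrier R" "c' \<in> carrier R" "d' \<in> carrier R"
      and nz: "b \<noteq> \<zero>" "d \<noteq> \<zero>" "b' \<noteq> \<zero>" "d' \<noteq> \<zero>"
      and 1: "a \<otimes> b' = a' \<otimes> b" and 2: "c \<otimes> d' = c' \<otimes> d"
    have "(a \<otimes> c) \<otimes> (b' \<otimes> d') = (a \<otimes> b') \<otimes> (c \<otimes> d')" using c by (simp add: m_ac)
    also have "\<dots> = (a' \<otimes> c') \<otimes> (b \<otimes> d)" unfolding 1 2 using c by (simp add: m_ac)
    finally show "fraction R (a \<otimes> c) (b \<otimes> d) = fraction R (a' \<otimes> c') (b' \<otimes> d')"
      using c nz by (subst frac_eq_iff) (auto simp: integral_iff)
  qed
  from UN_equiv_class2[OF frac_rel_equiv frac_rel_equiv this, of "(a,b)" "(c,d)"] assms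
  show ?thesis by (simp add: frac_field_def fraction_def case_prod_unfold)
qed

lemma frac_field_add:
  assumes "a \<in> carrier R" "b \<in> carrier R - {\<zero>}" "c \<in> carrier R" "d \<in> carrier R - {\<zero>}"
  shows "fraction R a b \<oplus>\<^bsub>frac_field R\<^esub> fraction R c d = fraction R (a \<otimes> d \<oplus> c \<otimes> b) (b \<otimes> d)"
proof -
  have "congruent2 (frac_rel R) (frac_rel R)
          (\<lambda>(a, b) (c, d). fraction R (a \<otimes> d \<oplus> c \<otimes> b) (b \<otimes> d))"
  proof (rule congruent2I', clarsimp simp: frac_rel_def)
    fix a b c d a' b' c' d'
    assume c: "a \<in> carrier R" "b \<in> carrier R" "c \<in> carrier R" "d \<in> carrier R"
      "a' \<in> carrier R" "b' \<in> carrier R" "c' \<in> carrier R" "d' \<in> carrier R"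
      and nz: "b \<noteq> \<zero>" "d \<noteq> \<zero>" "b' \<noteq> \<zero>" "d' \<noteq> \<zero>"
      and 1: "a \<otimes> b' = a' \<otimes> b" and 2: "c \<otimes> d' = c' \<otimes> d"
    have "(a \<otimes> d \<oplus> c \<otimes> b) \<otimes> (b' \<otimes> d') = (a \<otimes> b') \<otimes> (d \<otimes> d') \<oplus> (c \<otimes> d') \<otimes> (b \<otimes> b')"
      using c by (simp add: l_distr r_distr m_ac)
    also have "\<dots> = (a' \<otimes> d' \<oplus> c' \<otimes> b') \<otimes> (b \<otimes> d)"
      unfolding 1 2 using c by (simp add: l_distr r_distr m_ac)
    finally show "fraction R (a \<otimes> d \<oplus> c \<otimes> b) (b \<otimes> d) = fraction R (a' \<otimes> d' \<oplus> c' \<otimes> b') (b' \<otimes> d')"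
      using c nz by (subst frac_eq_iff) (auto simp: integral_iff)
  qed
  from UN_equiv_class2[OF frac_rel_equiv frac_rel_equiv this, of "(a,b)" "(c,d)"] assms
  show ?thesis by (simp add: frac_field_def fraction_def case_prod_unfold)
qed

lemma frac_field_one: "\<one>\<^bsub>frac_field R\<^esub> = fraction R \<one> \<one>"
  and frac_field_zero: "\<zero>\<^bsub>frac_field R\<^esub> = fraction R \<zero> \<one>"
  by (simp_all add: frac_field_def)

lemma field_frac_field: "field (frac_field R)"
proof (rule cring.cring_fieldI2)
  note defs = frac_field_mult frac_field_add frac_field_one frac_field_zero frac_eq_iff integral_iff
  have in_carrier: "fraction R a b \<in> carrier (frac_field R)"
    if "a \<in> carrier R" "b \<in> carrier R - {\<zero>}" for a b
    using that by (auto simp: carrier_frac_field)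
  have carrierE: thesis if "x \<in> carrier (frac_field R)"
    and "\<And>a b. x = fraction R a b \<Longrightarrow> a \<in> carrier R \<Longrightarrow> b \<in> carrier R \<Longrightarrow> b \<noteq> \<zero> \<Longrightarrow> thesis"
    for x thesis
    using that by (auto simp: carrier_frac_field)
  show "cring (frac_field R)"
  proof (intro cringI abelian_groupI comm_monoidI)
    fix x assume "x \<in> carrier (frac_field R)"
    then obtain a b where x: "x = fraction R a b" "a \<in> carrier R" "b \<in> carrier R" "b \<noteq> \<zero>"
      by (rule carrierE)
    have "fraction R (\<ominus> a) b \<oplus>\<^bsub>frac_field R\<^esub> x = \<zero>\<^bsub>frac_field R\<^esub>"
      using x by (simp add: defs l_minus l_neg)
    then show "\<exists>y\<in>carrier (frac_field R). y \<oplus>\<^bsub>frac_field R\<^esub> x = \<zero>\<^bsub>frac_field R\<^esub>"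
      using x by (intro bexI[of _ "fraction R (\<ominus> a) b"] in_carrier) auto
  next
    fix x y z
    assume "x \<in> carrier (frac_field R)" "y \<in> carrier (frac_field R)" "z \<in> carrier (frac_field R)"
    then obtain a b c d e f where
      x: "x = fraction R a b" "a \<in> carrier R" "b \<in> carrier R" "b \<noteq> \<zero>" and
      y: "y = fraction R c d" "c \<in> carrier R" "d \<in> carrier R" "d \<noteq> \<zero>" and
      z: "z = fraction R e f" "e \<in> carrier R" "f \<in> carrier R" "f \<noteq> \<zero>"
      by (metis carrierE)
    show "(x \<oplus>\<^bsub>frac_field R\<^esub> y) \<otimes>\<^bsub>frac_field R\<^esub> z =
        x \<otimes>\<^bsub>frac_field R\<^esub> z \<oplus>\<^bsub>frac_field R\<^esub> y \<otimes>\<^bsub>frac_field R\<^esub> z"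
      unfolding x(1) y(1) z(1) using x y z
      by (simp add: defs) (simp add: l_distr r_distr m_ac)
  qed (auto elim!: carrierE intro!: in_carrier
        simp: defs l_distr r_distr m_ac a_ac)
  show "\<zero>\<^bsub>frac_field R\<^esub> \<noteq> \<one>\<^bsub>frac_field R\<^esub>"
    by (simp add: defs)
  show "\<exists>y\<in>carrier (frac_field R). x \<otimes>\<^bsub>frac_field R\<^esub> y = \<one>\<^bsub>frac_field R\<^esub>"
    if "x \<in> carrier (frac_field R)" and nz: "x \<noteq> \<zero>\<^bsub>frac_field R\<^esub>" for x
  proof -
    from that obtain a b where x: "x = fraction R a b" "a \<in> carrier R" "b \<in> carrier R" "b \<noteq> \<zero>"
      by (metis carrierE)
    with nz have "a \<noteq> \<zero>" by (auto simp: defs)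
    with x show ?thesis
      by (intro bexI[of _ "fraction R b a"] in_carrier) (auto simp: defs m_ac)
  qed
qed

end


section \<open>The p-adic integers and the profinite integers\<close>

text \<open>
  The ring of p-adic integers is the inverse limit of the rings of integers modulo powers of \<open>p\<close>,
  with \<open>x n\<close> the representative in \<open>{0..<p ^ n}\<close> of the class of \<open>x\<close> modulo the \<open>n\<close>-th power of \<open>p\<close>
  (so \<open>x 0 = 0\<close>). Everything in this section is meant for prime \<open>p\<close> only.
\<close>

type_synonym padic = "nat \<Rightarrow> int"

definition Zp :: "nat \<Rightarrow> padic ring" where
  "Zp p =
    \<lparr>carrier = {x. (\<forall>n. x n \<in> {0..<int p ^ n}) \<and> (\<forall>n. x (Suc n) mod int p ^ n = x n)},
     monoid.mult = (\<lambda>x y n. (x n * y n) mod int p ^ n),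
     monoid.one = (\<lambda>n. 1 mod int p ^ n),
     ring.zero = (\<lambda>n. 0),
     ring.add = (\<lambda>x y n. (x n + y n) mod int p ^ n)\<rparr>"

definition Zp_topology :: "nat \<Rightarrow> padic topology" where
  "Zp_topology p =
     subtopology (product_topology (\<lambda>n. discrete_topology {0..<int p ^ n}) UNIV) (carrier (Zp p))"

definition Zhat_topology :: "(nat \<Rightarrow> padic) topology" where
  "Zhat_topology = product_topology Zp_topology {p. prime p}"

definition Qp :: "nat \<Rightarrow> (padic \<times> padic) set ring" where
  "Qp p = frac_field (Zp p)"

lemma topspace_Zp: "topspace (Zp_topology p) = carrier (Zp p)"
  by (auto simp: Zp_topology_def Zp_def)

lemma topspace_Zhat: "topspace Zhat_topology = (\<Pi>\<^sub>E p\<in>{p. prime p}. carrier (Zp p))"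
  by (simp add: Zhat_topology_def topspace_Zp)

lemma Zp_mod:
  assumes "x \<in> carrier (Zp p)" "m \<le> n"
  shows "x n mod int p ^ m = x m"
  using assms(2)
proof (induction n rule: dec_induct)
  case base
  then show ?case using assms(1) by (simp add: Zp_def)
next
  case (step n)
  have "x (Suc n) mod int p ^ m = (x (Suc n) mod int p ^ n) mod int p ^ m"
    using step(1) by (simp add: mod_mod_cancel le_imp_power_dvd)
  also have "x (Suc n) mod int p ^ n = x n"
    using assms(1) by (simp add: Zp_def)
  finally show ?case using step by simp
qed

lemma cring_Zp:
  assumes "prime p"
  shows "cring (Zp p)"
proof -
  have p: "0 < int p" using assms prime_gt_0_nat by simp
  have pd: "int p ^ n dvd int p * int p ^ n" for n by simp
  have closed: "(\<lambda>n. f n mod int p ^ n) \<in> carrier (Zp p)"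
    if "\<And>n. f (Suc n) mod int p ^ n = f n mod int p ^ n" for f
    using that p by (simp add: Zp_def mod_mod_cancel)
  have mod_id: "x n mod int p ^ n = x n" "x (Suc n) mod int p ^ n = x n"
    if "x \<in> carrier (Zp p)" for x n using that by (auto simp: Zp_def)
  have sums: "(x (Suc n) + y (Suc n)) mod int p ^ n = (x n + y n) mod int p ^ n"
    "(x (Suc n) * y (Suc n)) mod int p ^ n = (x n * y n) mod int p ^ n"
    if "x \<in> carrier (Zp p)" "y \<in> carrier (Zp p)" for x y n
    using mod_id(2)[OF that(1), of n] mod_id(2)[OF that(2), of n]
    by (metis mod_add_eq, metis mod_mult_eq)
  have ops: "\<one>\<^bsub>Zp p\<^esub> = (\<lambda>n. 1 mod int p ^ n)" "\<zero>\<^bsub>Zp p\<^esub> = (\<lambda>n. 0)"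
    "\<And>x y. x \<otimes>\<^bsub>Zp p\<^esub> y = (\<lambda>n. (x n * y n) mod int p ^ n)"
    "\<And>x y. x \<oplus>\<^bsub>Zp p\<^esub> y = (\<lambda>n. (x n + y n) mod int p ^ n)"
    by (simp_all add: Zp_def)
  show ?thesis
  proof (intro cringI abelian_groupI comm_monoidI)
    fix x assume x: "x \<in> carrier (Zp p)"
    have "(- x (Suc n)) mod int p ^ n = (- x n) mod int p ^ n" for n
      using mod_id(2)[OF x, of n] by (metis mod_minus_eq)
    then have "(\<lambda>n. (- x n) mod int p ^ n) \<in> carrier (Zp p)"
      by (rule closed)
    moreover have "(\<lambda>n. (- x n) mod int p ^ n) \<oplus>\<^bsub>Zp p\<^esub> x = \<zero>\<^bsub>Zp p\<^esub>"
      by (simp add: ops mod_add_left_eq)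
    ultimately show "\<exists>y\<in>carrier (Zp p). y \<oplus>\<^bsub>Zp p\<^esub> x = \<zero>\<^bsub>Zp p\<^esub>" by blast
  next
    show "\<zero>\<^bsub>Zp p\<^esub> \<in> carrier (Zp p)" using closed[of "\<lambda>_. 0"] by (simp add: ops)
  qed (auto simp: ops fun_eq_iff sums mod_id mod_simps algebra_simps intro!: closed)
qed

lemma domain_Zp:
  assumes "prime p"
  shows "domain (Zp p)"
proof (rule domain.intro[OF cring_Zp[OF assms]], unfold_locales)
  have "\<one>\<^bsub>Zp p\<^esub> 1 \<noteq> \<zero>\<^bsub>Zp p\<^esub> 1"
    using prime_gt_1_nat[OF assms] by (simp add: Zp_def)
  then show "\<one>\<^bsub>Zp p\<^esub> \<noteq> \<zero>\<^bsub>Zp p\<^esub>" by metis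
next
  fix x y assume xy: "x \<otimes>\<^bsub>Zp p\<^esub> y = \<zero>\<^bsub>Zp p\<^esub>" "x \<in> carrier (Zp p)" "y \<in> carrier (Zp p)"
  show "x = \<zero>\<^bsub>Zp p\<^esub> \<or> y = \<zero>\<^bsub>Zp p\<^esub>"
  proof (rule ccontr)
    assume "\<not> ?thesis"
    then obtain m n where mn: "x m \<noteq> 0" "y n \<noteq> 0"
      by (auto simp: Zp_def fun_eq_iff)
    have "int p ^ (m + n) dvd x (m + n) * y (m + n)"
      using fun_cong[OF xy(1), of "m + n"] by (auto simp: Zp_def)
    moreover have "prime (int p)" using assms by simp
    ultimately obtain i j where ij: "i + j = m + n" "int p ^ i dvd x (m + n)" "int p ^ j dvd y (m + n)"
      using prime_elem_power_dvd_prod prime_imp_prime_elem by metis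
    then have "m \<le> i \<or> n \<le> j" by linarith
    then show False
    proof
      assume "m \<le> i"
      then have "int p ^ m dvd x (m + n)" using ij(2) power_le_dvd by blast
      then show False using Zp_mod[OF xy(2), of m "m + n"] mn by simp
    next
      assume "n \<le> j"
      then have "int p ^ n dvd y (m + n)" using ij(3) power_le_dvd by blast
      then show False using Zp_mod[OF xy(3), of n "m + n"] mn by simp
    qed
  qed
qed

lemma field_Qp: "prime p \<Longrightarrow> field (Qp p)"
  unfolding Qp_def by (rule domain.field_frac_field[OF domain_Zp])


section \<open>Integer-valued polynomials\<close>

text \<open>The image of a rational number in the p-adic numbers.\<close>

definition Qp_of_rat :: "nat \<Rightarrow> rat \<Rightarrow> (padic \<times> padic) set" where
  "Qp_of_rat p q = (case quotient_of q of (a, b) \<Rightarrow>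
     fraction (Zp p) ([a] \<cdot>\<^bsub>Zp p\<^esub> \<one>\<^bsub>Zp p\<^esub>) ([b] \<cdot>\<^bsub>Zp p\<^esub> \<one>\<^bsub>Zp p\<^esub>))"

text \<open>The value in the p-adic numbers of a rational polynomial at a p-adic integer.\<close>

definition poly_Qp :: "nat \<Rightarrow> rat poly \<Rightarrow> padic \<Rightarrow> (padic \<times> padic) set" where
  "poly_Qp p f \<alpha> =
     (\<Oplus>\<^bsub>Qp p\<^esub>i\<in>{..degree f}. Qp_of_rat p (coeff f i) \<otimes>\<^bsub>Qp p\<^esub> (frac_embed (Zp p) \<alpha> [^]\<^bsub>Qp p\<^esub> i))"

definition Int_Q :: "(nat \<Rightarrow> padic) set \<Rightarrow> rat poly set" where
  "Int_Q E = {f. \<forall>\<alpha>\<in>E. \<forall>p. prime p \<longrightarrow> poly_Qp p f (\<alpha> p) \<in> frac_embed (Zp p) ` carrier (Zp p)}"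

definition proj_p :: "nat \<Rightarrow> (nat \<Rightarrow> padic) set \<Rightarrow> padic set" where
  "proj_p p E = (\<lambda>\<alpha>. \<alpha> p) ` E"

text \<open>
  The image of a set of p-adic integers in the quotient by the ideal generated by \<open>p\<close>, as a set of
  cosets. There are only \<open>p\<close> cosets, so \<open>card\<close> is the cardinality in the usual sense.
\<close>

definition image_mod_p :: "nat \<Rightarrow> padic set \<Rightarrow> padic set set" where
  "image_mod_p p A = (\<lambda>x. (PIdl\<^bsub>Zp p\<^esub> ([p] \<cdot>\<^bsub>Zp p\<^esub> \<one>\<^bsub>Zp p\<^esub>)) +>\<^bsub>Zp p\<^esub> x) ` A"


section \<open>Regular bases\<close>

abbreviation int_smult :: "int \<Rightarrow> rat poly \<Rightarrow> rat poly" where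
  "int_smult k f \<equiv> smult (of_int k) f"

lemma module_int_smult: "module int_smult"
  by unfold_locales (simp_all add: smult_add_left smult_add_right)

definition int_basis :: "rat poly set \<Rightarrow> rat poly set \<Rightarrow> bool" where
  "int_basis M B \<longleftrightarrow> module.independent int_smult B \<and> module.span int_smult B = M"

definition regular_basis :: "rat poly set \<Rightarrow> (nat \<Rightarrow> rat poly) \<Rightarrow> bool" where
  "regular_basis M f \<longleftrightarrow> (\<forall>n. degree (f n) = n) \<and> int_basis M (range f)"

end

theory Submission
  imports Defs "HOL-Number_Theory.Cong"
begin

text \<open>
  Let \<open>I\<^sub>n \<subseteq> \<rat>\<close> be the group of coefficients of \<open>x\<^sup>n\<close> of the members of degree at most \<open>n\<close> of
  \<open>Int_Q E\<close>. It contains \<open>1\<close>, and a regular basis exists iff every \<open>I\<^sub>n\<close> is cyclic, i.e. iff every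
  \<open>I\<^sub>n\<close> has bounded denominators. If \<open>E\<^sub>p\<close> takes at most \<open>n\<close> values \<open>r\<close> modulo \<open>p\<^sup>k\<close>, then the product of
  the \<open>x - r\<close> and a power of \<open>x\<close> shows that \<open>1 / p\<^sup>k \<in> I\<^sub>n\<close>; this makes both conditions necessary.
  Conversely, divided differences at \<open>n + 1\<close> points of \<open>E\<^sub>p\<close> bound the powers of \<open>p\<close> in the denominators
  of \<open>I\<^sub>n\<close>, and \<open>p\<close> does not occur at all if the points are distinct modulo \<open>p\<close>.

  The p-adic numbers enter only through approximations: \<open>f(\<alpha>)\<close> is a p-adic integer iff the rational
  numbers \<open>f(\<alpha> m)\<close>, with \<open>\<alpha> m\<close> the integer approximating \<open>\<alpha>\<close> modulo \<open>p\<^sup>m\<close>, eventually have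
  denominators prime to \<open>p\<close>.
\<close>

section \<open>Residues of p-adic integers\<close>

lemma Zp_ops:
  "\<one>\<^bsub>Zp p\<^esub> = (\<lambda>n. 1 mod int p ^ n)" "\<zero>\<^bsub>Zp p\<^esub> = (\<lambda>n. 0)"
  "x \<otimes>\<^bsub>Zp p\<^esub> y = (\<lambda>n. (x n * y n) mod int p ^ n)"
  "x \<oplus>\<^bsub>Zp p\<^esub> y = (\<lambda>n. (x n + y n) mod int p ^ n)"
  by (simp_all add: Zp_def)

lemma Zp_carrier_iff:
  assumes "prime p"
  shows "x \<in> carrier (Zp p) \<longleftrightarrow> (\<forall>n. x n mod int p ^ n = x n) \<and> (\<forall>n. x (Suc n) mod int p ^ n = x n)"
proof -
  have "x n \<in> {0..<int p ^ n} \<longleftrightarrow> x n mod int p ^ n = x n" for n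
    using prime_gt_0_nat[OF assms] by (simp add: mod_pos_pos_trivial) (metis mod_pos_pos_trivial pos_mod_bound pos_mod_sign of_nat_0_less_iff zero_less_power)
  then show ?thesis by (auto simp: Zp_def)
qed

lemma Zp_reduce_in_carrier:
  assumes "prime p" "\<And>n. [f (Suc n) = f n] (mod int p ^ n)"
  shows "(\<lambda>n. f n mod int p ^ n) \<in> carrier (Zp p)"
  using assms(2) unfolding Zp_carrier_iff[OF assms(1)] by (simp add: mod_mod_cancel cong_def)

lemma Zp_nat:
  assumes "prime p"
  shows "[(m::nat)] \<cdot>\<^bsub>Zp p\<^esub> \<one>\<^bsub>Zp p\<^esub> = (\<lambda>n. int m mod int p ^ n)"
proof -
  interpret cring "Zp p" using assms by (rule cring_Zp)
  show ?thesis
    by (induction m) (auto simp: Zp_ops mod_simps algebra_simps)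
qed

lemma Zp_int:
  assumes "prime p"
  shows "[(a::int)] \<cdot>\<^bsub>Zp p\<^esub> \<one>\<^bsub>Zp p\<^esub> = (\<lambda>n. a mod int p ^ n)"
proof -
  interpret cring "Zp p" using assms by (rule cring_Zp)
  have nat: "[(int m)] \<cdot>\<^bsub>Zp p\<^esub> \<one>\<^bsub>Zp p\<^esub> = (\<lambda>n. int m mod int p ^ n)" for m
    using Zp_nat[OF assms, of m] by (simp add: add_pow_def int_pow_int)
  show ?thesis
  proof (cases "a \<ge> 0")
    case True
    then show ?thesis using nat[of "nat a"] by simp
  next
    case False
    have "[a] \<cdot>\<^bsub>Zp p\<^esub> \<one>\<^bsub>Zp p\<^esub> = \<ominus>\<^bsub>Zp p\<^esub> ([(- a)] \<cdot>\<^bsub>Zp p\<^esub> \<one>\<^bsub>Zp p\<^esub>)"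
      using add.int_pow_neg[of "\<one>\<^bsub>Zp p\<^esub>" "-a"] unfolding group_add_class.minus_minus by simp
    also have "[(- a)] \<cdot>\<^bsub>Zp p\<^esub> \<one>\<^bsub>Zp p\<^esub> = (\<lambda>n. (-a) mod int p ^ n)"
      using nat[of "nat (-a)"] False by (simp only: int_nat_eq) (simp only: not_le neg_0_le_iff_le if_True less_imp_le)
    also have "\<ominus>\<^bsub>Zp p\<^esub> (\<lambda>n. (-a) mod int p ^ n) = (\<lambda>n. a mod int p ^ n)"
      by (rule minus_equality)
        (auto intro!: Zp_reduce_in_carrier assms simp: Zp_ops mod_simps)
    finally show ?thesis .
  qed
qed

text \<open>Write \<open>D = p^e * D'\<close> with \<open>D'\<close> prime to \<open>p\<close>. As
  \<open>D'\<close> is a unit modulo every power of \<open>p\<close>, only \<open>p^e\<close>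
  matters, and digit \<open>e\<close> of \<open>x\<close> shows whether \<open>p^e\<close> divides
  \<open>x\<close>. Applied with \<open>D = p\<close> to cosets and with \<open>D\<close> a common
  denominator to values of polynomials.\<close>

lemma Zp_multiple_iff:
  assumes p: "prime p" and x: "x \<in> carrier (Zp p)" and D: "D \<noteq> 0"
  defines "e \<equiv> multiplicity (int p) D"
  shows "(\<exists>y\<in>carrier (Zp p). x = y \<otimes>\<^bsub>Zp p\<^esub> (\<lambda>n. D mod int p ^ n)) \<longleftrightarrow> int p ^ e dvd x e"
proof
  assume "\<exists>y\<in>carrier (Zp p). x = y \<otimes>\<^bsub>Zp p\<^esub> (\<lambda>n. D mod int p ^ n)"
  then obtain y where "x = y \<otimes>\<^bsub>Zp p\<^esub> (\<lambda>n. D mod int p ^ n)" by blast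
  then have "x e = (y e * D) mod int p ^ e" by (simp add: Zp_ops mod_simps)
  moreover have "int p ^ e dvd D" unfolding e_def by (rule multiplicity_dvd)
  ultimately show "int p ^ e dvd x e" by simp
next
  assume dvd: "int p ^ e dvd x e"
  have pp: "prime (int p)" using p by simp
  obtain D' where D': "D = int p ^ e * D'" "\<not> int p dvd D'"
    using multiplicity_decompose'[of D "int p"] D pp unfolding e_def by (metis not_prime_unit)
  have ppos: "int p ^ n > 0" for n using prime_gt_0_nat[OF p] by simp
  have cop: "coprime D' (int p ^ n)" for n
    using D'(2) pp 
    using prime_imp_coprime[OF pp D'(2)] by (simp add: coprime_commute)
  \<comment> \<open>Division by \<open>D\<close> costs \<open>e\<close> digits, so the n-th digit of the quotient is read off from \<open>x (n + e)\<close>.\<close>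
  have "\<exists>y. 0 \<le> y \<and> y < int p ^ n \<and> [y * D = x (n + e)] (mod int p ^ (n + e))" for n
  proof -
    have "x (n + e) mod int p ^ e = x e" using Zp_mod[OF x] by simp
    then have "int p ^ e dvd x (n + e)" using dvd by (metis dvd_mod_iff dvd_refl)
    then obtain z where z: "x (n + e) = int p ^ e * z" by blast
    obtain u where u: "[D' * u = 1] (mod int p ^ n)" using cong_solve_coprime_int[OF cop] by blast
    define y where "y = (u * z) mod int p ^ n"
    have "[y * D' = (u * z) * D'] (mod int p ^ n)" unfolding y_def by (intro cong_mult) auto
    also have "(u * z) * D' = (D' * u) * z" by simp
    also have "[(D' * u) * z = 1 * z] (mod int p ^ n)" by (intro cong_mult u) auto
    finally have "[int p ^ e * (y * D') = int p ^ e * z] (mod int p ^ e * int p ^ n)"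
      by (simp add: cong_cmult_leftI)
    then have "[y * D = x (n + e)] (mod int p ^ (n + e))"
      by (simp add: z D'(1) power_add mult_ac)
    then show ?thesis using ppos[of n] unfolding y_def by (intro exI[of _ y]) (auto simp: y_def)
  qed
  then obtain y where y: "\<And>n. 0 \<le> y n" "\<And>n. y n < int p ^ n"
    "\<And>n. [y n * D = x (n + e)] (mod int p ^ (n + e))" by metis
  \<comment> \<open>Cancelling \<open>D\<close> loses \<open>e\<close> digits of precision; this
    makes the separately chosen digits \<open>y n\<close> compatible.\<close>
  have uniq: "[a = b] (mod int p ^ n)" if "[a * D = b * D] (mod int p ^ (n + e))" for a b n
  proof -
    have "int p ^ e * int p ^ n dvd int p ^ e * ((a - b) * D')"
      using that by (simp add: cong_iff_dvd_diff D'(1) power_add algebra_simps)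
    then have "int p ^ n dvd (a - b) * D'" using ppos[of e] by (subst (asm) dvd_times_left_cancel_iff) auto
    then show ?thesis using cop[of n] by (simp add: cong_iff_dvd_diff coprime_dvd_mult_left_iff coprime_commute)
  qed
  have xc: "[x (Suc n) = x n] (mod int p ^ n)" for n
    using x unfolding Zp_carrier_iff[OF p] cong_def by simp
  have "[y (Suc n) * D = y n * D] (mod int p ^ (n + e))" for n
  proof -
    have "[y (Suc n) * D = x (Suc n + e)] (mod int p ^ (n + e))"
      using y(3)[of "Suc n"] by (rule cong_dvd_modulus) (simp)
    also have "[x (Suc n + e) = x (n + e)] (mod int p ^ (n + e))" using xc[of "n + e"] by simp
    also have "[x (n + e) = y n * D] (mod int p ^ (n + e))" using y(3) by (rule cong_sym)
    finally show ?thesis .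
  qed
  then have "[y (Suc n) = y n] (mod int p ^ n)" for n by (rule uniq)
  then have "y \<in> carrier (Zp p)" using y(1,2) unfolding Zp_def cong_def by simp
  moreover have "x = y \<otimes>\<^bsub>Zp p\<^esub> (\<lambda>n. D mod int p ^ n)"
  proof
    fix n
    have "[y n * D = x (n + e)] (mod int p ^ n)"
      using y(3)[of n] by (rule cong_dvd_modulus) (simp add: power_add)
    then show "x n = (y \<otimes>\<^bsub>Zp p\<^esub> (\<lambda>n. D mod int p ^ n)) n"
      using Zp_mod[OF x, of n "n + e"] by (simp add: Zp_ops mod_simps cong_def)
  qed
  ultimately show "\<exists>y\<in>carrier (Zp p). x = y \<otimes>\<^bsub>Zp p\<^esub> (\<lambda>n. D mod int p ^ n)" by blast
qed

text \<open>Cosets agree iff the difference lies in the ideal, and \<open>Zp_multiple_iff\<close>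
  with \<open>D = p\<close>, hence \<open>e = 1\<close>, reads membership in the ideal off digit
  1.\<close>

lemma coset_p_eq_iff:
  assumes p: "prime p" and x: "x \<in> carrier (Zp p)" and y: "y \<in> carrier (Zp p)"
  defines "I \<equiv> PIdl\<^bsub>Zp p\<^esub> ([p] \<cdot>\<^bsub>Zp p\<^esub> \<one>\<^bsub>Zp p\<^esub>)"
  shows "I +>\<^bsub>Zp p\<^esub> x = I +>\<^bsub>Zp p\<^esub> y \<longleftrightarrow> x 1 = y 1"
proof -
  interpret cring "Zp p" using p by (rule cring_Zp)
  have pc: "[p] \<cdot>\<^bsub>Zp p\<^esub> \<one>\<^bsub>Zp p\<^esub> \<in> carrier (Zp p)" by simp
  interpret I: ideal I "Zp p" unfolding I_def by (rule cgenideal_ideal[OF pc])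
  have I_iff: "z \<in> I \<longleftrightarrow> z 1 = 0" if z: "z \<in> carrier (Zp p)" for z
  proof -
    have "z \<in> I \<longleftrightarrow> (\<exists>y\<in>carrier (Zp p). z = y \<otimes>\<^bsub>Zp p\<^esub> (\<lambda>n. int p mod int p ^ n))"
      unfolding I_def cgenideal_def Zp_nat[OF p] by auto
    also have "\<dots> \<longleftrightarrow> int p dvd z 1"
      using Zp_multiple_iff[OF p z, of "int p"] p prime_gt_0_nat[OF p] by simp
    also have "\<dots> \<longleftrightarrow> z 1 = 0"
      using z prime_gt_0_nat[OF p] unfolding Zp_carrier_iff[OF p] by (metis dvd_eq_mod_eq_0 power_one_right)
    finally show ?thesis .
  qed
  have "I +>\<^bsub>Zp p\<^esub> x = I +>\<^bsub>Zp p\<^esub> y \<longleftrightarrow> x \<ominus>\<^bsub>Zp p\<^esub> y \<in> I"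
    using quotient_eq_iff_same_a_r_cos[OF I.is_ideal x y] by simp
  also have "\<dots> \<longleftrightarrow> (x \<ominus>\<^bsub>Zp p\<^esub> y) 1 = 0" using x y by (intro I_iff) simp
  also have "\<dots> \<longleftrightarrow> x 1 = y 1"
  proof -
    \<comment> \<open>Digits of a difference are not directly available, so it is characterised by
      \<open>x = z + y\<close> and compared through addition.\<close>
    define z where "z = x \<ominus>\<^bsub>Zp p\<^esub> y"
    have z: "z \<in> carrier (Zp p)" and x_eq: "x = z \<oplus>\<^bsub>Zp p\<^esub> y"
      using x y by (simp_all add: z_def a_minus_def a_assoc l_neg)
    have "x 1 = (z 1 + y 1) mod int p" by (simp add: x_eq Zp_ops)
    moreover have "y 1 mod int p = y 1" "z 1 mod int p = z 1"
      using y z unfolding Zp_carrier_iff[OF p] by (metis power_one_right)+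
    ultimately have "z 1 = 0 \<longleftrightarrow> x 1 = y 1"
      using mod_eq_dvd_iff[of "z 1 + y 1" "int p" "y 1"] by (metis add_0 add_diff_cancel_right' dvd_eq_mod_eq_0)
    then show ?thesis by (simp add: z_def)
  qed
  finally show ?thesis .
qed

text \<open>Replaces cosets by digits: the later counting uses the values \<open>x 1\<close>
  alone.\<close>

lemma card_image_mod_p:
  assumes p: "prime p" and A: "A \<subseteq> carrier (Zp p)"
  shows "card (image_mod_p p A) = card ((\<lambda>x. x 1) ` A)"
proof -
  let ?c = "\<lambda>x. PIdl\<^bsub>Zp p\<^esub> ([p] \<cdot>\<^bsub>Zp p\<^esub> \<one>\<^bsub>Zp p\<^esub>) +>\<^bsub>Zp p\<^esub> x"
  have eq: "?c x = ?c y \<longleftrightarrow> x 1 = y 1" if "x \<in> A" "y \<in> A" for x y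
    using coset_p_eq_iff[OF p] that A by blast
  \<comment> \<open>\<open>h\<close> sends a residue to the coset of a chosen representative; its
    independence of the choice and its injectivity are the two directions of
    \<open>eq\<close>.\<close>
  define h where "h r = ?c (SOME x. x \<in> A \<and> x 1 = r)" for r
  have h: "h (x 1) = ?c x" if "x \<in> A" for x
  proof -
    have "(SOME y. y \<in> A \<and> y 1 = x 1) \<in> A \<and> (SOME y. y \<in> A \<and> y 1 = x 1) 1 = x 1"
      by (rule someI[of _ x]) (use that in simp)
    then show ?thesis unfolding h_def using eq that by simp
  qed
  have "image_mod_p p A = h ` ((\<lambda>x. x 1) ` A)" unfolding image_mod_p_def image_image by (intro image_cong refl) (use h in simp)
  moreover have "inj_on h ((\<lambda>x. x 1) ` A)" 
  proof (rule inj_onI, elim imageE)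
    fix r s x y assume *: "h r = h s" "r = x 1" "s = y 1" "x \<in> A" "y \<in> A"
    then have "?c x = ?c y" using h by metis
    then show "r = s" using eq * by simp
  qed
  ultimately show ?thesis by (simp add: card_image)
qed

section \<open>Integrality at a prime and divided differences\<close>

text \<open>For prime \<open>p\<close> this is the localization of the integers at \<open>p\<close>,
  i.e. the rationals lying in the p-adic integers. \<open>b \<noteq> 0\<close> is implicit, since
  \<open>p\<close> divides 0.\<close>

definition p_integral :: "nat \<Rightarrow> rat set" where
  "p_integral p = {of_int a / of_int b |a b. \<not> int p dvd b}"

lemma p_integralI: "\<not> int p dvd b \<Longrightarrow> q = of_int a / of_int b \<Longrightarrow> q \<in> p_integral p"
  by (auto simp: p_integral_def)

lemma p_integral_of_int: "prime p \<Longrightarrow> of_int a \<in> p_integral p"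
  by (rule p_integralI[where b = 1 and a = a]) auto

lemma p_integral_mult:
  assumes "prime p" "x \<in> p_integral p" "y \<in> p_integral p"
  shows "x * y \<in> p_integral p"
proof -
  obtain a b c d where "x = of_int a / of_int b" "\<not> int p dvd b"
    "y = of_int c / of_int d" "\<not> int p dvd d"
    using assms(2,3) by (auto simp: p_integral_def)
  then show ?thesis using assms(1)
    by (intro p_integralI[of p "b * d" _ "a * c"]) (auto simp: prime_dvd_mult_iff)
qed

lemma p_integral_add:
  assumes "prime p" "x \<in> p_integral p" "y \<in> p_integral p"
  shows "x + y \<in> p_integral p"
proof -
  obtain a b c d where ab: "x = of_int a / of_int b" "\<not> int p dvd b"
    "y = of_int c / of_int d" "\<not> int p dvd d"
    using assms(2,3) by (auto simp: p_integral_def)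
  then have "b \<noteq> 0" "d \<noteq> 0" by auto
  with ab show ?thesis using assms(1)
    by (intro p_integralI[of p "b * d" _ "a * d + c * b"])
      (auto simp: prime_dvd_mult_iff add_frac_eq)
qed

lemma p_integral_diff:
  assumes "prime p" "x \<in> p_integral p" "y \<in> p_integral p"
  shows "x - y \<in> p_integral p"
  using p_integral_add[OF assms(1,2) p_integral_mult[OF assms(1) p_integral_of_int[OF assms(1), of "-1"] assms(3)]]
  by simp

text \<open>The same divisibility condition as in \<open>Zp_multiple_iff\<close>, which is what ties
  rational integrality at \<open>p\<close> to integrality in \<open>Zp p\<close>.\<close>

lemma p_integral_divide_iff:
  assumes p: "prime p" and D: "D \<noteq> 0"
  shows "of_int a / of_int D \<in> p_integral p \<longleftrightarrow> int p ^ multiplicity (int p) D dvd a"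
proof
  define e where "e = multiplicity (int p) D"
  have pp: "prime (int p)" using p by simp
  obtain D' where D': "D = int p ^ e * D'" "\<not> int p dvd D'"
    using multiplicity_decompose'[of D "int p"] D pp unfolding e_def by (metis not_prime_unit)
  {
    assume "of_int a / of_int D \<in> p_integral p"
    then obtain b c where bc: "(of_int a / of_int D :: rat) = of_int b / of_int c" "\<not> int p dvd c"
      by (auto simp: p_integral_def)
    then have "c \<noteq> 0" by auto
    with bc D have "(of_int (a * c) :: rat) = of_int (b * D)" by (simp add: divide_simps)
    then have "a * c = b * D" by (simp only: of_int_eq_iff)
    then have "int p ^ e dvd a * c" by (simp add: D')
    moreover have "coprime (int p ^ e) c"
      using bc(2) pp by (metis coprime_power_left_iff prime_imp_coprime)
    ultimately show "int p ^ multiplicity (int p) D dvd a"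
      by (simp add: e_def coprime_dvd_mult_left_iff)
  next
    assume "int p ^ multiplicity (int p) D dvd a"
    then obtain b where "a = int p ^ e * b" by (auto simp: e_def)
    then show "of_int a / of_int D \<in> p_integral p"
      using D D' by (intro p_integralI[OF D'(2), of _ b]) auto
  }
qed

text \<open>A prime dividing the reduced denominator would, by integrality at that prime, also
  divide the numerator.\<close>

lemma p_integral_all_imp_Ints:
  assumes "\<And>p. prime p \<Longrightarrow> q \<in> p_integral p"
  shows "q \<in> \<int>"
proof -
  obtain a b where ab: "quotient_of q = (a, b)" by force
  have q: "q = of_int a / of_int b" "b > 0" "coprime a b"
    using quotient_of_div[OF ab] quotient_of_denom_pos[OF ab] quotient_of_coprime[OF ab] by auto
  have "b = 1"
  proof (rule ccontr)
    assume "b \<noteq> 1"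
    then obtain r where r: "prime r" "r dvd nat b" using q(2) prime_factor_nat[of "nat b"] by fastforce
    then have rb: "int r dvd b" using q(2) by (metis int_dvd_int_iff int_nat_eq less_imp_le)
    moreover have "int r ^ multiplicity (int r) b dvd a"
      using assms[OF r(1)] p_integral_divide_iff[OF r(1), of b a] q by auto
    moreover have "multiplicity (int r) b > 0"
      using rb q(2) r(1) by (simp add: prime_multiplicity_gt_zero_iff)
    ultimately have "int r dvd a" by (metis dvd_power dvd_trans)
    then have "is_unit (int r)" using rb q(3) by (meson not_coprimeI)
    then show False using r(1) by (metis not_prime_unit prime_nat_int_transfer)
  qed
  then show ?thesis using q by simp
qed

section \<open>Divided differences\<close>

lemma coeff_pCons_mult:
  fixes g :: "'a::comm_ring_1 poly"
  assumes "degree g \<le> n"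
  shows "coeff ([:- a, 1:] * g) (Suc n) = coeff g n"
  using assms by (simp add: coeff_eq_0 coeff_pCons)

text \<open>\<open>g\<close> is the divided difference \<open>(f(x) - f(a)) / (x - a)\<close>. It
  keeps the top coefficient while the degree bound drops, as the induction in
  \<open>coeff_p_integral\<close> requires.\<close>

lemma poly_divided_difference:
  fixes f :: "'a::idom poly"
  assumes "degree f \<le> Suc n"
  obtains g where "degree g \<le> n" "f = [:poly f a:] + [:- a, 1:] * g" "coeff f (Suc n) = coeff g n"
proof -
  have "poly (f - [:poly f a:]) a = 0" by simp
  then obtain g where g: "f - [:poly f a:] = [:- a, 1:] * g"
    unfolding poly_eq_0_iff_dvd by (elim dvdE)
  have deg: "degree g \<le> n"
  proof (cases "g = 0")
    case False
    then have "degree (f - [:poly f a:]) = Suc (degree g)" unfolding g by (subst degree_mult_eq) auto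
    then show ?thesis using assms degree_diff_le[of f "Suc n" "[:poly f a:]"] by simp
  qed simp
  have f: "f = [:poly f a:] + [:- a, 1:] * g" using g by (simp add: algebra_simps)
  have "coeff f (Suc n) = coeff g n"
    by (subst f, subst coeff_add, subst coeff_pCons_mult[OF deg]) simp
  then show ?thesis using that deg f by blast
qed

text \<open>Induction on \<open>n\<close>, passing to the divided difference \<open>g\<close> at the
  last point. Its values at the other points have the differences to the last point as denominators;
  the product \<open>c\<close> of these differences clears them all. For repeated points the product
  is 0 and the claim is empty.\<close>

lemma coeff_p_integral:
  fixes a :: "nat \<Rightarrow> int" and f :: "rat poly"
  assumes p: "prime p"
  assumes "degree f \<le> n" "\<And>i. i \<le> n \<Longrightarrow> poly f (of_int (a i)) \<in> p_integral p"
  shows "of_int (\<Prod>j\<le>n. \<Prod>i<j. a i - a j) * coeff f n \<in> p_integral p"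
  using assms(2,3)
proof (induction n arbitrary: f)
  case 0
  then show ?case by (auto elim!: degree_eq_zeroE)
next
  case (Suc n)
  let ?b = "of_int (a (Suc n)) :: rat"
  obtain g where g: "degree g \<le> n" "f = [:poly f ?b:] + [:- ?b, 1:] * g"
    "coeff f (Suc n) = coeff g n"
    using poly_divided_difference[OF Suc.prems(1)] by blast
  define c where "c = (\<Prod>i<Suc n. a i - a (Suc n))"
  have "poly (smult (of_int c) g) (of_int (a i)) \<in> p_integral p" if i: "i \<le> n" for i
  proof -
    \<comment> \<open>What remains of \<open>c\<close> once the factor for \<open>i\<close> has
      turned the value of \<open>g\<close> into a difference of values of \<open>f\<close>.\<close>
    define c' where "c' = (\<Prod>i\<in>{..<Suc n} - {i}. a i - a (Suc n))"
    have "c = (a i - a (Suc n)) * c'" unfolding c_def c'_def using i by (subst prod.remove[of _ i]) auto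
    moreover have "poly f (of_int (a i)) - poly f ?b = of_int (a i - a (Suc n)) * poly g (of_int (a i))"
      by (subst g(2)) (simp add: algebra_simps)
    ultimately have "poly (smult (of_int c) g) (of_int (a i)) =
        of_int c' * (poly f (of_int (a i)) - poly f ?b)" by simp
    also have "\<dots> \<in> p_integral p"
      using Suc.prems(2) i by (intro p_integral_mult p_integral_of_int p_integral_diff p) auto
    finally show ?thesis .
  qed
  then have "of_int (\<Prod>j\<le>n. \<Prod>i<j. a i - a j) * coeff (smult (of_int c) g) n \<in> p_integral p"
    using Suc.IH[of "smult (of_int c) g"] g(1) by (meson degree_smult_le order_trans)
  then show ?case by (simp add: c_def g(3) mult_ac)
qed

section \<open>Regular bases and leading coefficients\<close>

text \<open>Admitting degrees below \<open>n\<close>, which contribute 0, makes this a subgroup of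
  the rationals whenever \<open>M\<close> is a group.\<close>

definition leading_coeffs :: "rat poly set \<Rightarrow> nat \<Rightarrow> rat set" where
  "leading_coeffs M n = {coeff f n |f. f \<in> M \<and> degree f \<le> n}"

text \<open>The generator is the least positive member; the remainder of any member on division by
  it is a smaller member, hence 0.\<close>

lemma int_subgroup_cyclic:
  fixes S :: "int set"
  assumes "0 \<in> S" "\<And>x y. x \<in> S \<Longrightarrow> y \<in> S \<Longrightarrow> x - y \<in> S"
  obtains g where "S = {k * g |k. True}"
proof (cases "S = {0}")
  case True
  then show ?thesis using that[of 0] by auto
next
  case False
  have neg: "- x \<in> S" if "x \<in> S" for x using assms(2)[OF assms(1) that] by simp
  have add: "x + y \<in> S" if "x \<in> S" "y \<in> S" for x y using assms(2)[OF that(1) neg[OF that(2)]] by simp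
  have nmult: "int k * x \<in> S" if "x \<in> S" for k x
    by (induction k) (auto simp: assms(1) add that algebra_simps)
  have mult: "k * x \<in> S" if "x \<in> S" for k x
    using nmult[OF that, of "nat k"] neg[OF nmult[OF that, of "nat (- k)"]] by (cases "k \<ge> 0") auto
  obtain x where "x \<in> S" "x \<noteq> 0" using False assms(1) by blast
  then have ex: "\<exists>m. m > 0 \<and> int m \<in> S"
    using neg[of x] by (intro exI[of _ "nat \<bar>x\<bar>"]) (auto simp: abs_if)
  define g where "g = (LEAST m. m > 0 \<and> int m \<in> S)"
  have g: "g > 0" "int g \<in> S" using LeastI_ex[OF ex] by (auto simp: g_def)
  have least: "g \<le> m" if "m > 0" "int m \<in> S" for m using that unfolding g_def by (auto intro: Least_le)
  have "\<exists>k. y = k * int g" if y: "y \<in> S" for y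
  proof -
    have "y mod int g \<in> S"
      using assms(2)[OF y mult[OF g(2), of "y div int g"]] by (simp add: minus_div_mult_eq_mod)
    moreover have "0 \<le> y mod int g" "y mod int g < int g" using g(1) by auto
    ultimately have "y mod int g = 0" using least[of "nat (y mod int g)"] by fastforce
    then show ?thesis by (metis dvd_def mod_0_imp_dvd mult.commute)
  qed
  then show ?thesis using that[of "int g"] mult[OF g(2)] by blast
qed

interpretation int_poly: module int_smult
  by (rule module_int_smult)

text \<open>The degrees are distinct, so the term of largest degree among those with nonzero
  coefficient cannot cancel. This gives independence, and it keeps members of degree above
  \<open>n\<close> out of combinations of degree at most \<open>n\<close>. The nonvanishing excludes
  \<open>f 0 = 0\<close>, which the degree condition permits.\<close>

lemma regular_family_combination_coeff:
  fixes f :: "nat \<Rightarrow> rat poly"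
  assumes deg: "\<And>n. degree (f n) = n" and nz: "\<And>n. f n \<noteq> 0"
    and t: "finite t" "t \<subseteq> range f" and w: "w \<in> t" "u w \<noteq> 0"
  obtains m where "degree w \<le> m" "coeff (\<Sum>v\<in>t. int_smult (u v) v) m \<noteq> 0"
proof -
  \<comment> \<open>Terms with zero coefficient are discarded, so that \<open>m\<close> is a degree
    that really occurs.\<close>
  define s where "s = {v \<in> t. u v \<noteq> 0}"
  have s: "finite s" "w \<in> s" using t w by (auto simp: s_def)
  define m where "m = Max (degree ` s)"
  have "m \<in> degree ` s" unfolding m_def using s by (intro Max_in) auto
  then obtain v where v: "v \<in> s" "degree v = m" by auto
  have fv: "x = f (degree x)" if "x \<in> t" for x using t(2) that deg by fastforce
  have "coeff (int_smult (u x) x) m = 0" if x: "x \<in> t - {v}" for x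
  proof (cases "x \<in> s")
    case True
    then have "degree x \<le> m" using s(1) by (simp add: m_def)
    moreover have "degree x \<noteq> m" using fv[of x] fv[of v] x v by (auto simp: s_def)
    ultimately show ?thesis by (simp add: coeff_eq_0)
  qed (use x in \<open>simp add: s_def\<close>)
  then have "(\<Sum>x\<in>t - {v}. coeff (int_smult (u x) x) m) = 0" by (intro sum.neutral) blast
  moreover have "v \<in> t" using v(1) by (simp add: s_def)
  ultimately have "coeff (\<Sum>x\<in>t. int_smult (u x) x) m = coeff (int_smult (u v) v) m"
    using t(1) unfolding coeff_sum by (subst sum.remove[of t v]) auto
  also have "\<dots> \<noteq> 0"
  proof -
    have "v \<noteq> 0" using nz[of m] fv[of v] v by (auto simp: s_def)
    then have "coeff v m \<noteq> 0" using v(2) by auto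
    then show ?thesis using v(1) by (simp add: s_def)
  qed
  finally have "coeff (\<Sum>x\<in>t. int_smult (u x) x) m \<noteq> 0" .
  moreover have "degree w \<le> m" using s by (simp add: m_def)
  ultimately show ?thesis using that by blast
qed

lemma regular_family_independent:
  fixes f :: "nat \<Rightarrow> rat poly"
  assumes "\<And>n. degree (f n) = n" "\<And>n. f n \<noteq> 0"
  shows "int_poly.independent (range f)"
proof
  assume "int_poly.dependent (range f)"
  then obtain t u v where t: "finite t" "t \<subseteq> range f" "(\<Sum>v\<in>t. int_smult (u v) v) = 0"
    and "v \<in> t" "u v \<noteq> 0"
    unfolding int_poly.dependent_explicit by blast
  then show False
    using regular_family_combination_coeff[OF assms t(1,2), of v u] by auto
qed

text \<open>Choose \<open>f n\<close> so that its coefficient of \<open>x^n\<close> generates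
  \<open>leading_coeffs M n\<close>; subtracting integer multiples of the \<open>f n\<close> then
  lowers the degree of any member of \<open>M\<close> step by step.\<close>

lemma regular_basis_if_leading_coeffs_bounded:
  assumes M: "int_poly.subspace M" and one: "\<And>n. 1 \<in> leading_coeffs M n"
    and bdd: "\<And>n. \<exists>d::int. d \<noteq> 0 \<and> (\<forall>c\<in>leading_coeffs M n. of_int d * c \<in> \<int>)"
  shows "\<exists>f. regular_basis M f"
proof -
  have "\<exists>f. f \<in> M \<and> degree f = n \<and> f \<noteq> 0 \<and> (\<forall>c\<in>leading_coeffs M n. \<exists>k::int. c = of_int k * coeff f n)" for n
  proof -
    obtain d :: int where d: "d \<noteq> 0" "\<And>c. c \<in> leading_coeffs M n \<Longrightarrow> of_int d * c \<in> \<int>"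
      using bdd[of n] by blast
    \<comment> \<open>Multiplication by \<open>d\<close> carries the group of coefficients to a
      subgroup of the integers, which is cyclic.\<close>
    define S where "S = {z::int. of_int z / of_int d \<in> leading_coeffs M n}"
    have "0 \<in> S" unfolding S_def leading_coeffs_def using int_poly.subspace_0[OF M]
      by (auto intro!: exI[of _ 0])
    moreover have "x - y \<in> S" if xy: "x \<in> S" "y \<in> S" for x y
    proof -
      obtain f g where "f \<in> M" "degree f \<le> n" "of_int x / of_int d = coeff f n"
        "g \<in> M" "degree g \<le> n" "of_int y / of_int d = coeff g n"
        using xy by (auto simp: S_def leading_coeffs_def)
      then show ?thesis unfolding S_def leading_coeffs_def
        by (auto intro!: exI[of _ "f - g"] int_poly.subspace_diff[OF M] degree_diff_le
            simp: diff_divide_distrib)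
    qed
    ultimately obtain g where g: "S = {k * g |k. True}" by (rule int_subgroup_cyclic)
    have "g \<in> S" unfolding g by (auto intro!: exI[of _ 1])
    then obtain f where f: "f \<in> M" "degree f \<le> n" "coeff f n = of_int g / of_int d"
      by (auto simp: S_def leading_coeffs_def)
    have mult: "\<exists>k::int. c = of_int k * coeff f n" if c: "c \<in> leading_coeffs M n" for c
    proof -
      obtain z :: int where z: "of_int d * c = of_int z" using d(2)[OF c] by (auto elim: Ints_cases)
      then have "c = of_int z / of_int d" using d(1) by (simp add: field_simps)
      moreover from this have "z \<in> S" using c by (simp add: S_def)
      ultimately show ?thesis using f(3) unfolding g by auto
    qed
    \<comment> \<open>1 is a multiple of this coefficient, so it cannot vanish and the degree is
      exactly \<open>n\<close>.\<close>
    have "coeff f n \<noteq> 0" using mult[OF one] by auto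
    then have "degree f = n" "f \<noteq> 0" using f(2) le_degree by (auto intro: antisym)
    with f mult show ?thesis by blast
  qed
  then obtain f where f: "\<And>n. f n \<in> M" "\<And>n. degree (f n) = n" "\<And>n. f n \<noteq> 0"
    "\<And>n c. c \<in> leading_coeffs M n \<Longrightarrow> \<exists>k::int. c = of_int k * coeff (f n) n" by metis
  have reduce: "\<exists>k. h - int_smult k (f n) \<in> M \<and> degree (h - int_smult k (f n)) \<le> n \<and>
      coeff (h - int_smult k (f n)) n = 0" if h: "h \<in> M" "degree h \<le> n" for h n
  proof -
    obtain k where "coeff h n = of_int k * coeff (f n) n"
      using f(4)[of "coeff h n" n] h by (auto simp: leading_coeffs_def)
    then show ?thesis using h f(1,2)[of n] M
      by (intro exI[of _ k] conjI int_poly.subspace_diff int_poly.subspace_scale degree_diff_le)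
        (auto intro: order_trans[OF degree_smult_le])
  qed
  have "h \<in> int_poly.span (range f)" if "h \<in> M" "degree h \<le> n" for h n
    using that
  proof (induction n arbitrary: h)
    case (0 h)
    then obtain k where "degree (h - int_smult k (f 0)) \<le> 0" "coeff (h - int_smult k (f 0)) 0 = 0"
      using reduce by blast
    then have "h - int_smult k (f 0) = 0" by (metis le_zero_eq leading_coeff_0_iff)
    then have "h = int_smult k (f 0)" by simp
    then show ?case by (auto intro: int_poly.span_scale int_poly.span_base)
  next
    case (Suc n h)
    then obtain k where k: "h - int_smult k (f (Suc n)) \<in> M"
      "degree (h - int_smult k (f (Suc n))) \<le> Suc n" "coeff (h - int_smult k (f (Suc n))) (Suc n) = 0"
      using reduce by blast
    have "degree (h - int_smult k (f (Suc n))) \<noteq> Suc n"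
      using k(3) by (metis degree_0 leading_coeff_0_iff nat.distinct(1))
    then have "h - int_smult k (f (Suc n)) \<in> int_poly.span (range f)" using k Suc.IH by simp
    then have "(h - int_smult k (f (Suc n))) + int_smult k (f (Suc n)) \<in> int_poly.span (range f)"
      by (intro int_poly.span_add[OF _ int_poly.span_scale[OF int_poly.span_base]]) auto
    then show ?case by simp
  qed
  then have "M \<subseteq> int_poly.span (range f)" by blast
  moreover have "int_poly.span (range f) \<subseteq> M" using f(1) M by (intro int_poly.span_minimal) auto
  ultimately have "regular_basis M f"
    using f regular_family_independent[of f] by (auto simp: regular_basis_def int_basis_def)
  then show ?thesis by blast
qed

text \<open>In an integer combination of degree at most \<open>n\<close> only \<open>f n\<close>
  contributes to the coefficient of \<open>x^n\<close>. All these coefficients are therefore integer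
  multiples of that of \<open>f n\<close>, whose denominator \<open>b\<close> serves as
  \<open>d\<close>.\<close>

lemma leading_coeffs_bounded_if_regular_basis:
  assumes "regular_basis M f"
  shows "\<exists>d::int. d \<noteq> 0 \<and> (\<forall>c\<in>leading_coeffs M n. of_int d * c \<in> \<int>)"
proof -
  have deg: "degree (f n) = n" for n
    using assms by (simp add: regular_basis_def)
  have span: "int_poly.span (range f) = M"
    and ind: "int_poly.independent (range f)"
    using assms by (auto simp: regular_basis_def int_basis_def)
  obtain a b where ab: "quotient_of (coeff (f n) n) = (a, b)" by force
  have q: "coeff (f n) n = of_int a / of_int b" "b > 0"
    using quotient_of_div[OF ab] quotient_of_denom_pos[OF ab] by auto
  have nz: "f n \<noteq> 0" for n using ind int_poly.dependent_zero[of "range f"] by (metis rangeI)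
  have "\<exists>k::int. coeff h n = of_int k * coeff (f n) n" if h: "h \<in> M" "degree h \<le> n" for h
  proof -
    obtain t u where t: "finite t" "t \<subseteq> range f" "h = (\<Sum>v\<in>t. int_smult (u v) v)"
      using h(1) unfolding span[symmetric] int_poly.span_explicit by blast
    have fv: "w = f (degree w)" if "w \<in> t" for w using t(2) that deg by fastforce
    have le: "degree w \<le> n" if w: "w \<in> t" "u w \<noteq> 0" for w
    proof (rule ccontr)
      assume "\<not> degree w \<le> n"
      moreover obtain m where "degree w \<le> m" "coeff h m \<noteq> 0"
        unfolding t(3) by (rule regular_family_combination_coeff[where f = f and w = w and u = u]) (use deg nz t w in auto)
      ultimately show False using h(2) by (simp add: coeff_eq_0)
    qed
    have "coeff (int_smult (u w) w) n = of_int (if degree w = n then u w else 0) * coeff (f n) n"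
      if w: "w \<in> t" for w
      using le[OF w] fv[OF w] by (cases "u w = 0") (auto simp: coeff_eq_0)
    then have "coeff h n = of_int (\<Sum>w\<in>t. if degree w = n then u w else 0) * coeff (f n) n"
      unfolding t(3) coeff_sum by (simp add: sum_distrib_right)
    then show ?thesis by blast
  qed
  then have "of_int b * c \<in> \<int>" if "c \<in> leading_coeffs M n" for c
    using that q by (auto simp: leading_coeffs_def) (metis Ints_mult Ints_of_int nonzero_mult_div_cancel_left of_int_eq_0_iff order_less_irrefl times_divide_eq_right mult.left_commute)
  then show ?thesis using q(2) by (intro exI[of _ b]) auto
qed

section \<open>Values of rational polynomials at p-adic integers\<close>

definition Zp_of_int :: "nat \<Rightarrow> int \<Rightarrow> padic" where
  "Zp_of_int p a = (\<lambda>n. a mod int p ^ n)"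

lemma Zp_of_int_closed [simp]: "prime p \<Longrightarrow> Zp_of_int p a \<in> carrier (Zp p)"
  unfolding Zp_of_int_def by (rule Zp_reduce_in_carrier) auto

text \<open>A nonzero integer is divisible by finitely many powers of \<open>p\<close> only. Besides
  making \<open>Zp_of_int p D\<close> a legal denominator, this refutes a bound divisible by all
  powers of \<open>p\<close> in the final theorem.\<close>

lemma Zp_of_int_eq_zero_iff:
  assumes "prime p"
  shows "Zp_of_int p a = \<zero>\<^bsub>Zp p\<^esub> \<longleftrightarrow> a = 0"
proof
  assume "Zp_of_int p a = \<zero>\<^bsub>Zp p\<^esub>"
  then have dvd: "int p ^ n dvd a" for n
    by (auto simp: Zp_of_int_def Zp_ops fun_eq_iff)
  show "a = 0"
  proof (rule ccontr)
    assume "a \<noteq> 0"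
    moreover have "\<not> is_unit (int p)" using assms by (metis not_prime_unit prime_nat_int_transfer)
    ultimately have "Suc (multiplicity (int p) a) \<le> multiplicity (int p) a"
      using dvd[of "Suc (multiplicity (int p) a)"] by (intro multiplicity_geI)
    then show False by simp
  qed
qed (simp add: Zp_of_int_def Zp_ops)

lemma Zp_pow:
  assumes "prime p" "x \<in> carrier (Zp p)"
  shows "x [^]\<^bsub>Zp p\<^esub> (i::nat) = (\<lambda>n. x n ^ i mod int p ^ n)"
proof -
  interpret cring "Zp p" using assms(1) by (rule cring_Zp)
  show ?thesis
    by (induction i) (auto simp: Zp_ops mod_simps mult.commute)
qed

text \<open>\<open>Qp_of_rat\<close> uses the reduced fraction; allowing any representation lets all
  coefficients of a polynomial share one denominator.\<close>

lemma Qp_of_rat_quotient: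
  assumes p: "prime p" and D: "D \<noteq> 0"
  shows "Qp_of_rat p (of_int a / of_int D) = fraction (Zp p) (Zp_of_int p a) (Zp_of_int p D)"
proof -
  interpret domain "Zp p" using p by (rule domain_Zp)
  obtain a' b' where q: "quotient_of (of_int a / of_int D) = (a', b')" by force
  have b': "b' > 0" using quotient_of_denom_pos[OF q] .
  have "(of_int (a * b') :: rat) = of_int (a' * D)"
    using quotient_of_div[OF q] D b' by (simp add: field_simps)
  then have eq: "a * b' = a' * D" by (simp only: of_int_eq_iff)
  have "Qp_of_rat p (of_int a / of_int D) = fraction (Zp p) (Zp_of_int p a') (Zp_of_int p b')"
    by (simp add: Qp_of_rat_def q Zp_int[OF p] Zp_of_int_def)
  also have "\<dots> = fraction (Zp p) (Zp_of_int p a) (Zp_of_int p D)"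
    using p D b' eq by (subst frac_eq_iff) (auto simp: Zp_of_int_eq_zero_iff, simp add: Zp_of_int_def Zp_ops mod_simps)
  finally show ?thesis .
qed

lemma rat_poly_common_denominator:
  fixes f :: "rat poly"
  obtains D :: int and A :: "nat \<Rightarrow> int" where "D \<noteq> 0" "\<And>i. coeff f i = of_int (A i) / of_int D"
proof -
  have "\<exists>D::int. \<exists>A. D \<noteq> 0 \<and> (\<forall>i. coeff f i = of_int (A i) / of_int D)"
  proof (induction f)
    case 0
    then show ?case by (intro exI[of _ 1] exI[of _ "\<lambda>_. 0"]) auto
  next
    case (pCons c f)
    then obtain D :: int and A where DA: "D \<noteq> 0" "\<And>i. coeff f i = of_int (A i) / of_int D" by blast
    obtain a b where q: "quotient_of c = (a, b)" by force
    have c: "c = of_int a / of_int b" "b \<noteq> 0"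
      using quotient_of_div[OF q] quotient_of_denom_pos[OF q] by auto
    show ?case
      by (intro exI[of _ "D * b"] exI[of _ "\<lambda>i. case i of 0 \<Rightarrow> a * D | Suc i \<Rightarrow> A i * b"])
        (use DA c in \<open>auto simp: coeff_pCons split: nat.split\<close>)
  qed
  then show ?thesis using that by blast
qed

text \<open>Over a common denominator \<open>D\<close> the value at \<open>x\<close> is
  \<open>S / D\<close>, where the digits of \<open>S\<close> are the reduced integer values
  \<open>G (x n)\<close>. By \<open>Zp_multiple_iff\<close> integrality is a condition modulo
  \<open>p^e\<close>, and by \<open>p_integral_divide_iff\<close> the same condition governs the
  rational value at \<open>x n\<close> as soon as \<open>n \<ge> e\<close>.\<close>

lemma poly_Qp_integral_iff:
  assumes p: "prime p" and x: "x \<in> carrier (Zp p)"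
  shows "poly_Qp p f x \<in> frac_embed (Zp p) ` carrier (Zp p) \<longleftrightarrow>
    (\<forall>\<^sub>F n in sequentially. poly f (of_int (x n)) \<in> p_integral p)"
proof -
  interpret domain "Zp p" using p by (rule domain_Zp)
  interpret Q: field "Qp p" using p by (rule field_Qp)
  obtain D A where D: "D \<noteq> 0" and A: "\<And>i. coeff f i = of_int (A i) / of_int D"
    using rat_poly_common_denominator[of f] by blast
  define e where "e = multiplicity (int p) D"
  \<comment> \<open>\<open>G (degree f)\<close> is the integer polynomial \<open>D * f\<close>, and
    \<open>S (degree f)\<close> its p-adic value at \<open>x\<close>; the truncations at
    \<open>m\<close> serve the induction over the finite sum.\<close>
  define G where "G m y = (\<Sum>i\<le>m. A i * y ^ i)" for m and y :: int
  define S where "S m = (\<lambda>n. G m (x n) mod int p ^ n)" for m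
  have G_cong: "[G m y = G m z] (mod k)" if "[y = z] (mod k)" for m y z k
    unfolding G_def by (intro cong_sum cong_mult cong_pow that) auto
  have x_cong: "[x n = x m] (mod int p ^ m)" if "m \<le> n" for m n
    using Zp_mod[OF x that] by (simp add: cong_def) (metis mod_mod_trivial)
  have S_closed: "S m \<in> carrier (Zp p)" for m
    unfolding S_def by (intro Zp_reduce_in_carrier p G_cong x_cong) simp
  note D_nz = Zp_of_int_eq_zero_iff[OF p] D
  let ?D = "Zp_of_int p D"
  have D_in: "?D \<in> carrier (Zp p) - {\<zero>\<^bsub>Zp p\<^esub>}" using p by (simp add: D_nz)
  have one_in: "\<one>\<^bsub>Zp p\<^esub> \<in> carrier (Zp p) - {\<zero>\<^bsub>Zp p\<^esub>}" by simp
  have frac_closed: "fraction (Zp p) y ?D \<in> carrier (Qp p)" if "y \<in> carrier (Zp p)" for y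
    using that D_in by (auto simp: Qp_def carrier_frac_field)
  have pow: "frac_embed (Zp p) x [^]\<^bsub>Qp p\<^esub> i = fraction (Zp p) (x [^]\<^bsub>Zp p\<^esub> i) \<one>\<^bsub>Zp p\<^esub>" for i :: nat
  proof (induction i)
    case 0
    then show ?case by (simp add: Qp_def frac_field_one)
  next
    case (Suc i)
    then show ?case using x one_in by (simp add: Qp_def frac_embed_def frac_field_mult)
  qed
  let ?t = "\<lambda>i. Qp_of_rat p (coeff f i) \<otimes>\<^bsub>Qp p\<^esub> (frac_embed (Zp p) x [^]\<^bsub>Qp p\<^esub> i)"
  have t: "?t i = fraction (Zp p) (Zp_of_int p (A i) \<otimes>\<^bsub>Zp p\<^esub> x [^]\<^bsub>Zp p\<^esub> i) ?D" for i
    unfolding A Qp_of_rat_quotient[OF p D] pow unfolding Qp_def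
    using x p D_in one_in by (subst frac_field_mult) auto
  have t_closed: "?t i \<in> carrier (Qp p)" for i
    unfolding t using x p by (intro frac_closed) auto
  \<comment> \<open>The sum formula gives the denominator \<open>D * D\<close>; one factor
    \<open>D\<close> cancels, so the denominator stays fixed.\<close>
  have add: "fraction (Zp p) y ?D \<oplus>\<^bsub>Qp p\<^esub> fraction (Zp p) z ?D = fraction (Zp p) (y \<oplus>\<^bsub>Zp p\<^esub> z) ?D"
    if "y \<in> carrier (Zp p)" "z \<in> carrier (Zp p)" for y z
    unfolding Qp_def using that D_in
    by (subst frac_field_add; simp?) (subst frac_eq_iff; simp add: integral_iff l_distr m_assoc)
  have "(\<Oplus>\<^bsub>Qp p\<^esub>i\<in>{..m}. ?t i) = fraction (Zp p) (S m) ?D" for m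
  proof (induction m)
    case 0
    have "Zp_of_int p (A 0) \<otimes>\<^bsub>Zp p\<^esub> x [^]\<^bsub>Zp p\<^esub> (0::nat) = S 0"
      by (simp add: S_def G_def Zp_pow[OF p x] Zp_of_int_def Zp_ops mod_simps)
    moreover have "(\<Oplus>\<^bsub>Qp p\<^esub>i\<in>{..0}. ?t i) = ?t 0"
      using t_closed by (intro Q.finsum_0 funcsetI)
    ultimately show ?case unfolding t by (simp only:)
  next
    case (Suc m)
    have "Zp_of_int p (A (Suc m)) \<otimes>\<^bsub>Zp p\<^esub> x [^]\<^bsub>Zp p\<^esub> Suc m \<oplus>\<^bsub>Zp p\<^esub> S m = S (Suc m)"
      unfolding Zp_pow[OF p x] by (simp add: S_def G_def Zp_of_int_def Zp_ops mod_simps add.commute)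
    moreover have "(\<Oplus>\<^bsub>Qp p\<^esub>i\<in>{..Suc m}. ?t i) = ?t (Suc m) \<oplus>\<^bsub>Qp p\<^esub> (\<Oplus>\<^bsub>Qp p\<^esub>i\<in>{..m}. ?t i)"
      using t_closed by (intro Q.finsum_Suc) auto
    ultimately show ?case
      unfolding Suc.IH unfolding t using add S_closed x p by simp
  qed
  then have "poly_Qp p f x = fraction (Zp p) (S (degree f)) ?D" by (simp add: poly_Qp_def)
  then have "poly_Qp p f x \<in> frac_embed (Zp p) ` carrier (Zp p) \<longleftrightarrow>
      (\<exists>y\<in>carrier (Zp p). fraction (Zp p) (S (degree f)) ?D = fraction (Zp p) y \<one>\<^bsub>Zp p\<^esub>)"
    by (auto simp: frac_embed_def)
  also have "\<dots> \<longleftrightarrow> (\<exists>y\<in>carrier (Zp p). S (degree f) = y \<otimes>\<^bsub>Zp p\<^esub> ?D)"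
    using S_closed D_in by (intro bex_cong refl) (subst frac_eq_iff; simp)
  also have "\<dots> \<longleftrightarrow> int p ^ e dvd S (degree f) e"
    unfolding Zp_of_int_def e_def by (rule Zp_multiple_iff[OF p S_closed D])
  also have "\<dots> \<longleftrightarrow> int p ^ e dvd G (degree f) (x e)"
    by (simp add: S_def dvd_mod_iff)
  finally have mem_iff: "poly_Qp p f x \<in> frac_embed (Zp p) ` carrier (Zp p) \<longleftrightarrow>
      int p ^ e dvd G (degree f) (x e)" .
  have poly_eq: "poly f (of_int y) = of_int (G (degree f) y) / of_int D" for y
    by (simp add: poly_altdef A G_def sum_divide_distrib)
  \<comment> \<open>From \<open>e\<close> on the approximations agree modulo \<open>p^e\<close>,
    hence so do the values of \<open>G\<close>, and the condition no longer depends on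
    \<open>n\<close>.\<close>
  have "poly f (of_int (x n)) \<in> p_integral p \<longleftrightarrow> int p ^ e dvd G (degree f) (x e)" if "n \<ge> e" for n
    unfolding poly_eq p_integral_divide_iff[OF p D] e_def[symmetric]
    by (rule cong_dvd_iff[OF G_cong[OF x_cong[OF that]]])
  then have "\<forall>\<^sub>F n in sequentially. poly f (of_int (x n)) \<in> p_integral p \<longleftrightarrow>
      poly_Qp p f x \<in> frac_embed (Zp p) ` carrier (Zp p)"
    unfolding mem_iff eventually_sequentially by blast
  then have "(\<forall>\<^sub>F n in sequentially. poly f (of_int (x n)) \<in> p_integral p) \<longleftrightarrow>
      (\<forall>\<^sub>F n in sequentially. poly_Qp p f x \<in> frac_embed (Zp p) ` carrier (Zp p))"
    by (rule eventually_subst)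
  then show ?thesis by simp
qed

section \<open>Leading coefficients of integer-valued polynomials\<close>

text \<open>Values in \<open>Qp p\<close> disappear from the argument here: membership is tested on
  rational values at integers, one prime at a time.\<close>

lemma Int_Q_iff:
  assumes "E \<subseteq> topspace Zhat_topology"
  shows "f \<in> Int_Q E \<longleftrightarrow> (\<forall>p. prime p \<longrightarrow> (\<forall>x\<in>proj_p p E.
    \<forall>\<^sub>F n in sequentially. poly f (of_int (x n)) \<in> p_integral p))"
proof -
  have "\<alpha> p \<in> carrier (Zp p)" if "\<alpha> \<in> E" "prime p" for \<alpha> p
    using assms that unfolding topspace_Zhat by (auto simp: PiE_def Pi_def)
  then show ?thesis by (auto simp: Int_Q_def proj_p_def poly_Qp_integral_iff)
qed

lemma proj_p_subset_carrier:
  assumes "E \<subseteq> topspace Zhat_topology" "prime p"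
  shows "proj_p p E \<subseteq> carrier (Zp p)"
  using assms unfolding topspace_Zhat proj_p_def by (auto simp: PiE_def Pi_def)

lemma subspace_Int_Q:
  assumes "E \<subseteq> topspace Zhat_topology"
  shows "int_poly.subspace (Int_Q E)"
  unfolding int_poly.subspace_def Int_Q_iff[OF assms]
proof (intro conjI ballI allI impI; (elim allE impE, assumption)?)
  fix p x assume p: "prime p" and x: "x \<in> proj_p p E"
  show "\<forall>\<^sub>F n in sequentially. poly 0 (of_int (x n)) \<in> p_integral p"
    using p_integral_of_int[OF p, of 0] by simp
next
  fix f g :: "rat poly" and p x
  assume *: "f \<in> Int_Q E" "g \<in> Int_Q E" "prime p" "x \<in> proj_p p E"
  have "\<forall>\<^sub>F n in sequentially. poly f (of_int (x n)) \<in> p_integral p"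
    "\<forall>\<^sub>F n in sequentially. poly g (of_int (x n)) \<in> p_integral p"
    using * Int_Q_iff[OF assms] by blast+
  then show "\<forall>\<^sub>F n in sequentially. poly (f + g) (of_int (x n)) \<in> p_integral p"
    by eventually_elim (simp add: p_integral_add *)
next
  fix f :: "rat poly" and p x c
  assume *: "f \<in> Int_Q E" "prime p" "x \<in> proj_p p E"
  have "\<forall>\<^sub>F n in sequentially. poly f (of_int (x n)) \<in> p_integral p"
    using * Int_Q_iff[OF assms] by blast+
  then show "\<forall>\<^sub>F n in sequentially. poly (int_smult c f) (of_int (x n)) \<in> p_integral p"
    by eventually_elim (simp add: p_integral_mult p_integral_of_int *)
qed

section \<open>Few residues force large denominators\<close>

lemma monic_poly_vanishing_on:
  fixes R :: "int set"
  assumes "finite R" "card R \<le> n"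
  obtains g :: "int poly" where "degree g = n" "lead_coeff g = 1" "\<And>y. y \<in> R \<Longrightarrow> poly g y = 0"
proof -
  define h where "h = (\<Prod>r\<in>R. [:- r, 1:])"
  have "degree h = card R"
    unfolding h_def by (subst degree_prod_eq_sum_degree) auto
  moreover have "lead_coeff h = 1"
    unfolding h_def lead_coeff_prod by simp
  ultimately have h: "degree h = card R" "lead_coeff h = 1" by auto
  then have "h \<noteq> 0" by auto
  \<comment> \<open>The power of \<open>x\<close> raises the degree from \<open>card R\<close> to
    exactly \<open>n\<close>.\<close>
  then have "degree (monom 1 (n - card R) * h) = n"
    using h assms by (subst degree_mult_eq) (auto simp: degree_monom_eq)
  moreover have "lead_coeff (monom 1 (n - card R) * h) = 1"
    unfolding lead_coeff_mult h(2) by (simp add: degree_monom_eq)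
  moreover have "poly (monom 1 (n - card R) * h) y = 0" if "y \<in> R" for y
    using that assms(1) by (auto simp: h_def poly_prod)
  ultimately show ?thesis using that by blast
qed

lemma diff_dvd_poly_diff:
  fixes g :: "'a::comm_ring_1 poly"
  shows "y - z dvd poly g y - poly g z"
proof (induction g)
  case (pCons a g)
  have "poly (pCons a g) y - poly (pCons a g) z = (y - z) * poly g y + z * (poly g y - poly g z)"
    by (simp add: algebra_simps)
  then show ?case using pCons.IH by simp
qed simp

text \<open>Divide by \<open>p^k\<close> a monic integer polynomial of degree \<open>n\<close> that
  vanishes at the residues modulo \<open>p^k\<close>. From digit \<open>k\<close> on, its values at
  approximations of points of \<open>proj_p p E\<close> are divisible by \<open>p^k\<close>; at the
  other primes this denominator is harmless.\<close>

lemma inverse_prime_power_in_leading_coeffs: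
  assumes E: "E \<subseteq> topspace Zhat_topology" and p: "prime p"
    and R: "finite ((\<lambda>x. x k) ` proj_p p E)" "card ((\<lambda>x. x k) ` proj_p p E) \<le> n"
  shows "1 / of_nat p ^ k \<in> leading_coeffs (Int_Q E) n"
proof -
  obtain g :: "int poly" where g: "degree g = n" "lead_coeff g = 1"
    "\<And>x. x \<in> proj_p p E \<Longrightarrow> poly g (x k) = 0"
    by (rule monic_poly_vanishing_on[OF R]) blast
  define f :: "rat poly" where "f = smult (1 / of_nat p ^ k) (map_poly of_int g)"
  have p0: "p \<noteq> 0" using p by auto
  have "poly (map_poly of_int g) (of_int y :: rat) = of_int (poly g y)" for y
    by (induction g) (auto simp: map_poly_pCons)
  then have f_val: "poly f (of_int y) = of_int (poly g y) / of_int (int p ^ k)" for y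
    by (simp add: f_def)
  have "f \<in> Int_Q E"
    unfolding Int_Q_iff[OF E]
  proof (intro allI impI ballI)
    fix q x assume q: "prime q" and x: "x \<in> proj_p q E"
    have "poly f (of_int (x n)) \<in> p_integral q" if n: "n \<ge> k" for n
    proof (cases "q = p")
      case True
      have "x n mod int p ^ k = x k"
        using Zp_mod[of x p k n] proj_p_subset_carrier[OF E p] x n True by blast
      then have "int p ^ k dvd x n - x k" by (metis mod_eq_dvd_iff mod_mod_trivial)
      also have "x n - x k dvd poly g (x n) - poly g (x k)" by (rule diff_dvd_poly_diff)
      finally have "int p ^ k dvd poly g (x n)" using g(3) x True by simp
      then obtain z where "poly g (x n) = int p ^ k * z" by blast
      then have "poly f (of_int (x n)) = of_int z" using p0 by (simp add: f_val)
      then show ?thesis using p_integral_of_int[OF q] by simp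
    next
      case False
      have "\<not> int q dvd int p ^ k"
        using False p q by (metis int_dvd_int_iff of_nat_power prime_dvd_power primes_dvd_imp_eq)
      then show ?thesis using f_val by (rule p_integralI)
    qed
    then show "\<forall>\<^sub>F n in sequentially. poly f (of_int (x n)) \<in> p_integral q"
      by (auto simp: eventually_sequentially)
  qed
  moreover have "degree f \<le> n" unfolding f_def using g(1) by (simp add: degree_map_poly)
  moreover have "coeff f n = 1 / of_nat p ^ k" using g(1,2) by (simp add: f_def coeff_map_poly)
  ultimately show ?thesis unfolding leading_coeffs_def by force
qed

section \<open>Many residues bound the denominators\<close>

text \<open>For points distinct modulo \<open>p^(k+1)\<close> each difference carries at most
  \<open>p^k\<close>, so the differences in \<open>coeff_p_integral\<close> may be replaced by
  \<open>p^k\<close>. For \<open>k = 0\<close>, i.e. points distinct modulo \<open>p\<close>,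
  nothing is lost.\<close>

lemma leading_coeff_p_integral:
  assumes p: "prime p" and x: "\<And>i. i \<le> n \<Longrightarrow> x i \<in> carrier (Zp p)"
    and inj: "inj_on (\<lambda>i. x i (Suc k)) {..n}" and deg: "degree f \<le> n"
    and int: "\<And>i. i \<le> n \<Longrightarrow> \<forall>\<^sub>F m in sequentially. poly f (of_int (x i m)) \<in> p_integral p"
  shows "of_int (\<Prod>j\<le>n. \<Prod>i<j. int p ^ k) * coeff f n \<in> p_integral p"
proof -
  have "\<forall>\<^sub>F m in sequentially. \<forall>i\<in>{..n}. poly f (of_int (x i m)) \<in> p_integral p"
    using int by (intro eventually_ball_finite) auto
  then have "\<forall>\<^sub>F m in sequentially. m \<ge> Suc k \<and> (\<forall>i\<in>{..n}. poly f (of_int (x i m)) \<in> p_integral p)"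
    using eventually_ge_at_top by (rule eventually_conj[rotated])
  \<comment> \<open>One \<open>m\<close> serves all \<open>n + 1\<close> points;
    \<open>m \<ge> Suc k\<close> keeps the approximations distinct modulo
    \<open>p^(k+1)\<close>.\<close>
  then obtain m where m: "m \<ge> Suc k" "\<And>i. i \<le> n \<Longrightarrow> poly f (of_int (x i m)) \<in> p_integral p"
    using eventually_happens by force
  define a where "a i = x i m" for i
  have quot: "of_int (int p ^ k) / of_int (a i - a j) \<in> p_integral p \<and> a i \<noteq> a j"
    if ij: "j \<le> n" "i < j" for i j
  proof -
    have "x i (Suc k) \<noteq> x j (Suc k)" using inj ij by (auto simp: inj_on_def)
    moreover have "a l mod int p ^ Suc k = x l (Suc k)" if "l \<le> n" for l
      unfolding a_def using Zp_mod[OF x[OF that] m(1)] .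
    ultimately have ndvd: "\<not> int p ^ Suc k dvd a i - a j"
      using ij by (metis mod_eq_dvd_iff less_imp_le order_trans)
    then have ne: "a i \<noteq> a j" by auto
    have "multiplicity (int p) (a i - a j) \<le> k"
      using ndvd by (metis multiplicity_dvd' not_less_eq_eq)
    then have "int p ^ multiplicity (int p) (a i - a j) dvd int p ^ k" by (rule le_imp_power_dvd)
    then show ?thesis using ne by (subst p_integral_divide_iff[OF p]) auto
  qed
  have prod: "(\<Prod>i\<in>I. h i) \<in> p_integral p" if "\<And>i. i \<in> I \<Longrightarrow> h i \<in> p_integral p" for I :: "nat set" and h
    using that p_integral_of_int[OF p, of 1]
    by (induction I rule: infinite_finite_induct) (auto intro: p_integral_mult[OF p])
  define P where "P = (\<Prod>j\<le>n. \<Prod>i<j. a i - a j)"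
  have "P \<noteq> 0" unfolding P_def using quot by (auto simp: prod_zero_iff)
  have "of_int (\<Prod>j\<le>n. \<Prod>i<j. int p ^ k) / of_int P =
      (\<Prod>j\<le>n. \<Prod>i<j. of_int (int p ^ k) / of_int (a i - a j) :: rat)"
    unfolding P_def by (simp only: of_int_prod prod_dividef)
  also have "\<dots> \<in> p_integral p" using quot by (intro prod) auto
  finally have "(of_int P * coeff f n) * (of_int (\<Prod>j\<le>n. \<Prod>i<j. int p ^ k) / of_int P) \<in> p_integral p"
    unfolding P_def using m(2) by (intro p_integral_mult[OF p] coeff_p_integral[OF p deg]) (auto simp: a_def)
  then show ?thesis using \<open>P \<noteq> 0\<close> by (simp add: mult_ac)
qed

lemma inj_family_of_card_image:
  assumes "card (h ` A) > (n::nat)"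
  obtains x :: "nat \<Rightarrow> 'a" where "\<And>i. i \<le> n \<Longrightarrow> x i \<in> A" "inj_on (\<lambda>i. h (x i)) {..n}"
proof -
  obtain T where T: "T \<subseteq> h ` A" "card T = Suc n" "finite T"
    using obtain_subset_with_card_n[of "Suc n" "h ` A"] assms by auto
  obtain b where b: "bij_betw b {0..<Suc n} T" using ex_bij_betw_nat_finite[OF T(3)] T(2) by auto
  then have bi: "b i \<in> h ` A" "inj_on b {..n}" if "i \<le> n" for i
    using T(1) that by (auto simp: bij_betw_def atLeast0LessThan lessThan_Suc_atMost)
  then have "\<forall>i\<le>n. \<exists>y. y \<in> A \<and> h y = b i" by (metis imageE)
  then obtain x where x: "\<And>i. i \<le> n \<Longrightarrow> x i \<in> A \<and> h (x i) = b i" by metis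
  moreover have "inj_on (\<lambda>i. h (x i)) {..n}" using bi(2)[of 0] x by (simp add: inj_on_def)
  ultimately show ?thesis using that by blast
qed

lemma finite_Zp_image:
  assumes "A \<subseteq> carrier (Zp p)"
  shows "finite ((\<lambda>x. x k) ` A)"
  by (rule finite_subset[of _ "{0..<int p ^ k}"]) (use assms in \<open>auto simp: Zp_def\<close>)

text \<open>Distinct p-adic integers have distinct digits from some index on, and finitely many
  pairs admit a common index. The form \<open>Suc k\<close> fits
  \<open>leading_coeff_p_integral\<close>.\<close>

lemma infinite_Zp_large_image:
  assumes A: "A \<subseteq> carrier (Zp p)" "infinite A"
  obtains k where "card ((\<lambda>x. x (Suc k)) ` A) > n"
proof -
  obtain B where B: "finite B" "card B = Suc n" "B \<subseteq> A"
    using infinite_arbitrarily_large[OF A(2)] by blast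
  have sep: "\<forall>\<^sub>F k in sequentially. x \<noteq> y \<longrightarrow> x k \<noteq> y k" if xy: "x \<in> B" "y \<in> B" for x y
  proof (cases "x = y")
    case False
    then obtain m where m: "x m \<noteq> y m" by auto
    have x: "x \<in> carrier (Zp p)" and y: "y \<in> carrier (Zp p)" using xy A(1) B(3) by auto
    have "x k \<noteq> y k" if "k \<ge> m" for k
      using Zp_mod[OF x that] Zp_mod[OF y that] m by auto
    then show ?thesis by (auto simp: eventually_sequentially)
  qed simp
  have "\<forall>\<^sub>F k in sequentially. \<forall>x\<in>B. \<forall>y\<in>B. x \<noteq> y \<longrightarrow> x k \<noteq> y k"
    using sep B(1) by (intro eventually_ball_finite ballI) auto
  then obtain k where "\<forall>x\<in>B. \<forall>y\<in>B. x \<noteq> y \<longrightarrow> x (Suc k) \<noteq> y (Suc k)"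
    unfolding eventually_sequentially by (meson le_SucI order_refl)
  then have "inj_on (\<lambda>x. x (Suc k)) B" by (auto simp: inj_on_def)
  then have "Suc n = card ((\<lambda>x. x (Suc k)) ` B)" using B(2) by (simp add: card_image)
  also have "\<dots> \<le> card ((\<lambda>x. x (Suc k)) ` A)"
    using B(3) by (intro card_mono finite_Zp_image[OF A(1)]) auto
  finally show ?thesis using that[of k] by simp
qed

lemma one_in_leading_coeffs_Int_Q:
  assumes "E \<subseteq> topspace Zhat_topology"
  shows "1 \<in> leading_coeffs (Int_Q E) n"
proof -
  have "poly (monom 1 n) (of_int y) \<in> p_integral p" if "prime p" for p y
    using p_integral_of_int[OF that, of "y ^ n"] by (simp add: poly_monom)
  then have "monom 1 n \<in> Int_Q E" unfolding Int_Q_iff[OF assms] by simp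
  then show ?thesis unfolding leading_coeffs_def
    by (intro CollectI exI[of _ "monom 1 n"]) (simp add: degree_monom_eq)
qed

text \<open>At each prime, \<open>n + 1\<close> points distinct modulo \<open>p^(k p + 1)\<close>
  bound the power of \<open>p\<close> in the denominators. Outside a finite set of primes
  \<open>k p = 0\<close> works, so a finite product clears all denominators.\<close>

lemma leading_coeffs_Int_Q_bounded:
  assumes E: "E \<subseteq> topspace Zhat_topology"
    and inf: "\<And>p. prime p \<Longrightarrow> infinite (proj_p p E)"
    and fin: "finite {p. prime p \<and> \<not> card ((\<lambda>x. x 1) ` proj_p p E) > n}"
  shows "\<exists>d::int. d \<noteq> 0 \<and> (\<forall>c\<in>leading_coeffs (Int_Q E) n. of_int d * c \<in> \<int>)"
proof -
  let ?F = "{p. prime p \<and> \<not> card ((\<lambda>x. x 1) ` proj_p p E) > n}"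
  have "\<exists>k. card ((\<lambda>x. x (Suc k)) ` proj_p p E) > n \<and> (p \<notin> ?F \<longrightarrow> k = 0)" if p: "prime p" for p
  proof (cases "p \<in> ?F")
    case True
    then show ?thesis
      using infinite_Zp_large_image[OF proj_p_subset_carrier[OF E p] inf[OF p], of n] by blast
  next
    case False
    then show ?thesis using p by (intro exI[of _ 0]) simp
  qed
  then obtain k where k: "\<And>p. prime p \<Longrightarrow> card ((\<lambda>x. x (Suc (k p))) ` proj_p p E) > n"
    "\<And>p. prime p \<Longrightarrow> p \<notin> ?F \<Longrightarrow> k p = 0"
    using bchoice[of "{p. prime p}" "\<lambda>p k. card ((\<lambda>x. x (Suc k)) ` proj_p p E) > n \<and> (p \<notin> ?F \<longrightarrow> k = 0)"]
    by blast
  \<comment> \<open>This is \<open>p\<close> to the power \<open>k p * n * (n + 1) / 2\<close>, one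
    factor \<open>p^(k p)\<close> for each pair \<open>i < j\<close> with \<open>j \<le> n\<close>;
    it is 1 if \<open>k p = 0\<close>.\<close>
  define \<delta> where "\<delta> p = (\<Prod>j\<le>n. \<Prod>i<j. int p ^ k p)" for p
  have local: "of_int (\<delta> p) * c \<in> p_integral p" if p: "prime p" and c: "c \<in> leading_coeffs (Int_Q E) n" for p c
  proof -
    obtain f where f: "f \<in> Int_Q E" "degree f \<le> n" "c = coeff f n" using c by (auto simp: leading_coeffs_def)
    obtain x where x: "\<And>i. i \<le> n \<Longrightarrow> x i \<in> proj_p p E" "inj_on (\<lambda>i. x i (Suc (k p))) {..n}"
      by (rule inj_family_of_card_image[OF k(1)[OF p]]) auto
    have "x i \<in> carrier (Zp p)" if "i \<le> n" for i
      using x(1)[OF that] proj_p_subset_carrier[OF E p] by blast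
    moreover have "\<forall>\<^sub>F m in sequentially. poly f (of_int (x i m)) \<in> p_integral p" if "i \<le> n" for i
      using f(1) x(1)[OF that] p unfolding Int_Q_iff[OF E] by blast
    ultimately show ?thesis unfolding \<delta>_def f(3)
      by (intro leading_coeff_p_integral[where x = x] p x(2) f(2))
  qed
  define d where "d = prod \<delta> ?F"
  have "d \<noteq> 0" unfolding d_def \<delta>_def using fin by (auto simp: prod_zero_iff)
  moreover have "of_int d * c \<in> \<int>" if c: "c \<in> leading_coeffs (Int_Q E) n" for c
  proof (rule p_integral_all_imp_Ints)
    fix p :: nat assume p: "prime p"
    have "\<delta> p dvd d"
    proof (cases "p \<in> ?F")
      case True
      then have "\<delta> p dvd d" unfolding d_def by (rule dvd_prodI[OF fin])
      then show ?thesis by simp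
    next
      case False
      then have "\<delta> p = 1" using k(2)[OF p] by (simp add: \<delta>_def)
      then show ?thesis by simp
    qed
    then obtain e where "d = \<delta> p * e" by blast
    then have "of_int d * c = of_int e * (of_int (\<delta> p) * c)" by simp
    also have "\<dots> \<in> p_integral p" by (intro p_integral_mult p_integral_of_int local p c)
    finally show "of_int d * c \<in> p_integral p" .
  qed
  ultimately show ?thesis by blast
qed

section \<open>The two implications of the criterion\<close>

lemma int_divide_in_Ints_imp_dvd:
  assumes "of_int d * (1 / of_nat p ^ k) \<in> (\<int> :: rat set)" "p > 0"
  shows "int p ^ k dvd d"
proof -
  obtain z :: int where "of_int d * (1 / of_nat p ^ k) = (of_int z :: rat)"
    using assms(1) by (auto elim: Ints_cases)
  then have "(of_int d :: rat) = of_int (z * int p ^ k)" using assms(2) by (simp add: field_simps)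
  then have "d = z * int p ^ k" by (simp only: of_int_eq_iff)
  then show ?thesis by simp
qed

theorem corollary4p6:
  fixes E :: "(nat \<Rightarrow> padic) set"
  assumes "compactin Zhat_topology E"
  shows "(\<exists>f. regular_basis (Int_Q E) f) \<longleftrightarrow>
    (\<forall>p. prime p \<longrightarrow> infinite (proj_p p E)) \<and>
    (\<forall>n. finite {p. prime p \<and> \<not> card (image_mod_p p (proj_p p E)) > n})"
proof -
  have E: "E \<subseteq> topspace Zhat_topology" using assms by (simp add: compactin_def)
  have card_eq: "card (image_mod_p p (proj_p p E)) = card ((\<lambda>x. x 1) ` proj_p p E)" if "prime p" for p
    by (rule card_image_mod_p[OF that proj_p_subset_carrier[OF E that]])
  have set_eq: "{p. prime p \<and> \<not> card (image_mod_p p (proj_p p E)) > n} =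
      {p. prime p \<and> \<not> card ((\<lambda>x. x 1) ` proj_p p E) > n}" for n
    using card_eq by auto
  show ?thesis unfolding set_eq
  proof (intro iffI conjI allI impI)
    assume "\<exists>f. regular_basis (Int_Q E) f"
    then have bdd: "\<exists>d::int. d \<noteq> 0 \<and> (\<forall>c\<in>leading_coeffs (Int_Q E) n. of_int d * c \<in> \<int>)" for n
      using leading_coeffs_bounded_if_regular_basis by blast
    {
      fix p :: nat assume p: "prime p"
      show "infinite (proj_p p E)"
      proof
        assume fin: "finite (proj_p p E)"
        \<comment> \<open>The degree is the number of points: there are at most that many residues
          modulo every \<open>p^k\<close>, so every \<open>1 / p^k\<close> is a leading coefficient
          and \<open>d\<close> is divisible by all powers of \<open>p\<close>.\<close>
        obtain d :: int where d: "d \<noteq> 0"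
          "\<And>c. c \<in> leading_coeffs (Int_Q E) (card (proj_p p E)) \<Longrightarrow> of_int d * c \<in> \<int>"
          using bdd by blast
        have "int p ^ k dvd d" for k
          using fin prime_gt_0_nat[OF p]
          by (intro int_divide_in_Ints_imp_dvd d(2) inverse_prime_power_in_leading_coeffs[OF E p] card_image_le) auto
        then have "Zp_of_int p d = \<zero>\<^bsub>Zp p\<^esub>" by (auto simp: Zp_of_int_def Zp_ops)
        then show False using d(1) Zp_of_int_eq_zero_iff[OF p] by simp
      qed
    next
      fix n
      obtain d :: int where d: "d \<noteq> 0" "\<And>c. c \<in> leading_coeffs (Int_Q E) n \<Longrightarrow> of_int d * c \<in> \<int>"
        using bdd by blast
      \<comment> \<open>A prime with at most \<open>n\<close> residues puts \<open>1 / p\<close>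
        among the coefficients, hence divides \<open>d\<close>.\<close>
      have "p \<le> nat \<bar>d\<bar>" if p: "prime p" and card: "\<not> card ((\<lambda>x. x 1) ` proj_p p E) > n" for p
      proof -
        have "1 / of_nat p ^ 1 \<in> leading_coeffs (Int_Q E) n"
          using card
          by (intro inverse_prime_power_in_leading_coeffs[OF E p] finite_Zp_image[OF proj_p_subset_carrier[OF E p]]) simp
        then have "int p ^ 1 dvd d"
          by (intro int_divide_in_Ints_imp_dvd d(2) prime_gt_0_nat[OF p])
        then have "int p \<le> \<bar>d\<bar>" using d(1) dvd_imp_le_int[of d "int p"] by simp
        then show ?thesis by simp
      qed
      then have "{p. prime p \<and> \<not> card ((\<lambda>x. x 1) ` proj_p p E) > n} \<subseteq> {..nat \<bar>d\<bar>}" by auto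
      then show "finite {p. prime p \<and> \<not> card ((\<lambda>x. x 1) ` proj_p p E) > n}"
        by (rule finite_subset) simp
    }
  next
    assume *: "(\<forall>p. prime p \<longrightarrow> infinite (proj_p p E)) \<and>
      (\<forall>n. finite {p. prime p \<and> \<not> card ((\<lambda>x. x 1) ` proj_p p E) > n})"
    then show "\<exists>f. regular_basis (Int_Q E) f"
      using regular_basis_if_leading_coeffs_bounded[OF subspace_Int_Q[OF E] one_in_leading_coeffs_Int_Q[OF E]]
        leading_coeffs_Int_Q_bounded[OF E] by blast
  qed
qed

end
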